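(* Let $\mu_i=\mathcal N(m_i,\Sigma_i)$, $i\in\{0,1\}$, be two Gaussian distributions on $\mathbb R^d$ with eigendecompositions $\Sigma_i=P_iA_iP_i^T$, where $P_i$ is orthogonal and $A_i$ is diagonal with diagonal vector $a_i=(a_{i,1},\dots,a_{i,d})$ consisting of the eigenvalues of $\Sigma_i$ in the order $a_{i,1}\le\cdots\le a_{i,d}$. Then $$\bar d^2(\mu_0,\mu_1)=\|\sqrt{a_0}-\sqrt{a_1}\|^2=\sum_{j=1}^d\big(\sqrt{a_{0,j}}-\sqrt{a_{1,j}}\big)^2 .$$ An optimal orthogonal transformation (i.e. a $\theta\in O(d)$ attaining the infimum defining $\bar d^2(\mu_0,\mu_1)$) is $\theta=P_1P_0^T$. If $\Sigma_0$ is positive definite, the optimal Monge map is the $W_2$-optimal transport map from the centered Gaussian with covariance $P_1P_0^T\Sigma_0P_0P_1^T$ to the centered Gaussian with covariance $\Sigma_1$.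
   Context: $W_2$ is the quadratic Wasserstein distance (no factor $1/2$). Covariance matrices are symmetric positive semidefinite (possibly singular). For $\mu$ with finite second moment, $\bar\mu$ denotes its centered version (pushforward under $x\mapsto x-\int y\,d\mu(y)$), and $\theta_\#\bar\mu$ the pushforward under $x\mapsto\theta x$. The Procrustes--Wasserstein distance is $$\bar d^2(\mu_0,\mu_1):=\inf_{\theta\in O(d)}W_2^2(\theta_\#\bar\mu_0,\bar\mu_1).$$ The square root of a vector is taken componentwise and $\|\cdot\|$ is the Euclidean norm. *)

theory Defs
  imports "HOL-Probability.Probability"
begin

section \<open>Matrices\<close>

definition diag_matrix :: "real ^ 'n \<Rightarrow> real ^ 'n ^ 'n" where
  "diag_matrix a = (\<chi> i j. if i = j then a $ i else 0)"

definition vec_sqrt :: "real ^ 'n \<Rightarrow> real ^ 'n" where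
  "vec_sqrt a = (\<chi> i. sqrt (a $ i))"

definition pos_semidef :: "real ^ 'n ^ 'n \<Rightarrow> bool" where
  "pos_semidef S \<longleftrightarrow> transpose S = S \<and> (\<forall>x. 0 \<le> x \<bullet> (S *v x))"

definition pos_def :: "real ^ 'n ^ 'n \<Rightarrow> bool" where
  "pos_def S \<longleftrightarrow> transpose S = S \<and> (\<forall>x. x \<noteq> 0 \<longrightarrow> 0 < x \<bullet> (S *v x))"

text \<open>A positive semidefinite matrix has exactly one positive semidefinite square root; for
  other matrices the value below is irrelevant.\<close>

definition psd_sqrt :: "real ^ 'n ^ 'n \<Rightarrow> real ^ 'n ^ 'n" where
  "psd_sqrt S = (THE B. pos_semidef B \<and> B ** B = S)"

section \<open>Gaussian measures\<close>

definition std_gaussian :: "(real ^ 'n) measure" where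
  "std_gaussian = density lborel (\<lambda>z. ennreal (\<Prod>i\<in>UNIV. std_normal_density (z $ i)))"

text \<open>The Gaussian with mean \<open>m\<close> and positive semidefinite covariance \<open>S\<close> is the law of
  \<open>m + S^(1/2) Z\<close> for standard Gaussian \<open>Z\<close>. This covers singular \<open>S\<close>, where no density exists.\<close>

definition multivariate_normal :: "real ^ 'n \<Rightarrow> real ^ 'n ^ 'n \<Rightarrow> (real ^ 'n) measure" where
  "multivariate_normal m S = distr std_gaussian borel (\<lambda>z. m + psd_sqrt S *v z)"

section \<open>Optimal transport\<close>

definition couplings ::
  "'a::euclidean_space measure \<Rightarrow> 'a measure \<Rightarrow> ('a \<times> 'a) measure set" where
  "couplings \<mu> \<nu> =
    {\<pi>. sets \<pi> = sets (borel \<Otimes>\<^sub>M borel) \<and> distr \<pi> borel fst = \<mu> \<and> distr \<pi> borel snd = \<nu>}"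

text \<open>The squared quadratic Wasserstein distance. It is extended-real-valued, so that
  finiteness is part of any claim that it equals a real number.\<close>

definition W2_sq :: "'a::euclidean_space measure \<Rightarrow> 'a measure \<Rightarrow> ennreal" where
  "W2_sq \<mu> \<nu> = (INF \<pi>\<in>couplings \<mu> \<nu>. \<integral>\<^sup>+ (x, y). ennreal ((norm (x - y))\<^sup>2) \<partial>\<pi>)"

definition W2_optimal_map ::
  "'a::euclidean_space measure \<Rightarrow> 'a measure \<Rightarrow> ('a \<Rightarrow> 'a) \<Rightarrow> bool" where
  "W2_optimal_map \<mu> \<nu> T \<longleftrightarrow>
     T \<in> borel_measurable borel \<and> distr \<mu> borel T = \<nu> \<and>
     (\<integral>\<^sup>+ x. ennreal ((norm (x - T x))\<^sup>2) \<partial>\<mu>) = W2_sq \<mu> \<nu>"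

section \<open>The Procrustes--Wasserstein distance\<close>

definition centered :: "'a::euclidean_space measure \<Rightarrow> 'a measure" where
  "centered \<mu> = distr \<mu> borel (\<lambda>x. x - (\<integral>y. y \<partial>\<mu>))"

definition pushforward_matrix :: "real ^ 'n ^ 'n \<Rightarrow> (real ^ 'n) measure \<Rightarrow> (real ^ 'n) measure" where
  "pushforward_matrix \<theta> \<mu> = distr \<mu> borel (\<lambda>x. \<theta> *v x)"

definition PW_sq :: "(real ^ 'n) measure \<Rightarrow> (real ^ 'n) measure \<Rightarrow> ennreal" where
  "PW_sq \<mu>0 \<mu>1 =
    (INF \<theta>\<in>{\<theta>. orthogonal_matrix \<theta>}. W2_sq (pushforward_matrix \<theta> (centered \<mu>0)) (centered \<mu>1))"

definition PW_optimal_orthogonal ::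
  "(real ^ 'n) measure \<Rightarrow> (real ^ 'n) measure \<Rightarrow> real ^ 'n ^ 'n \<Rightarrow> bool" where
  "PW_optimal_orthogonal \<mu>0 \<mu>1 \<theta> \<longleftrightarrow>
     orthogonal_matrix \<theta> \<and>
     W2_sq (pushforward_matrix \<theta> (centered \<mu>0)) (centered \<mu>1) = PW_sq \<mu>0 \<mu>1"

text \<open>For a given orthogonal matrix \<open>\<theta>\<close>, a Monge map transports the aligned centered source to the
  centered target; it is optimal if its cost attains the squared Procrustes--Wasserstein
  distance.\<close>

definition PW_optimal_monge_map ::
  "(real ^ 'n) measure \<Rightarrow> (real ^ 'n) measure \<Rightarrow> real ^ 'n ^ 'n \<Rightarrow> (real ^ 'n \<Rightarrow> real ^ 'n) \<Rightarrow> bool"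
  where
  "PW_optimal_monge_map \<mu>0 \<mu>1 \<theta> T \<longleftrightarrow>
     orthogonal_matrix \<theta> \<and> T \<in> borel_measurable borel \<and>
     distr (pushforward_matrix \<theta> (centered \<mu>0)) borel T = centered \<mu>1 \<and>
     (\<integral>\<^sup>+ x. ennreal ((norm (x - T x))\<^sup>2) \<partial>(pushforward_matrix \<theta> (centered \<mu>0))) = PW_sq \<mu>0 \<mu>1"

end

theory Submission
  imports Defs
begin

text \<open>In coordinates \<open>u\<close>, \<open>v\<close> along eigenbases of the two covariances, the transport cost of a
  coupling is \<open>\<Sum>j. a0 j + a1 j\<close> minus twice \<open>\<Sum>i j. R i j * E[v i * u j]\<close> with \<open>R\<close> orthogonal, and
  replacing \<open>\<mu>0\<close> by its image under an orthogonal matrix changes only \<open>R\<close>. Each entry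
  \<open>E[v i * u j]\<close> is \<open>sqrt (a1 i) * sqrt (a0 j)\<close> times a correlation coefficient \<open>K i j\<close>, and
  \<open>R i j * K i j\<close> is dominated by a doubly substochastic matrix, so the rearrangement inequality
  bounds the cross term by \<open>\<Sum>j. sqrt (a1 j) * sqrt (a0 j)\<close>. The map \<open>P1 ** transpose P0\<close> aligns
  the eigenbases, whereupon scaling along the common axes attains the bound. An optimal map must
  attain equality in the Cauchy--Schwarz inequality on every axis, which makes it unique.\<close>

section \<open>Square roots of positive semidefinite matrices\<close>

lemma diag_matrix_mult_vector: "(diag_matrix a *v x) $ i = a $ i * x $ i"
  by (simp add: diag_matrix_def matrix_vector_mult_def if_distrib[of "\<lambda>y. y * _"] cong: if_cong)

lemma transpose_diag_matrix: "transpose (diag_matrix a) = diag_matrix a"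
  by (auto simp: diag_matrix_def transpose_def vec_eq_iff)

lemma diag_matrix_mult: "diag_matrix a ** diag_matrix b = diag_matrix (\<chi> i. a $ i * b $ i)"
  by (rule matrix_eq[THEN iffD2])
    (simp add: matrix_vector_mul_assoc[symmetric] vec_eq_iff diag_matrix_mult_vector)

lemma inner_matrix_vector_left:
  fixes A :: "real ^ 'n ^ 'm"
  shows "(A *v x) \<bullet> y = x \<bullet> (transpose A *v y)"
  by (metis dot_lmul_matrix inner_commute transpose_matrix_vector transpose_transpose)

lemma orthogonal_matrix_cancel:
  fixes P :: "real ^ 'n ^ 'n"
  assumes "orthogonal_matrix P"
  shows "transpose P ** P = mat 1" "P ** transpose P = mat 1"
    "A ** transpose P ** P = A" "A ** P ** transpose P = A"
    "transpose P *v (P *v x) = x" "P *v (transpose P *v x) = x"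
proof -
  show *: "transpose P ** P = mat 1" "P ** transpose P = mat 1"
    using assms by (auto simp: orthogonal_matrix_def)
  show "A ** transpose P ** P = A" "A ** P ** transpose P = A"
    by (simp_all add: matrix_mul_assoc[symmetric] *)
  show "transpose P *v (P *v x) = x" "P *v (transpose P *v x) = x"
    by (simp_all add: matrix_vector_mul_assoc * del: transpose_matrix_vector)
qed

lemma norm_orthogonal_matrix_mult:
  fixes P :: "real ^ 'n ^ 'n"
  assumes "orthogonal_matrix P"
  shows "norm (P *v x) = norm x"
  by (simp add: norm_eq_sqrt_inner inner_matrix_vector_left orthogonal_matrix_cancel[OF assms]
      del: transpose_matrix_vector)

text \<open>The squared entries of \<open>R\<close> form a doubly stochastic matrix, which is how
  the orthogonal change of frame enters the rearrangement bound.\<close>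

lemma orthogonal_matrix_sum_squares:
  fixes R :: "real ^ 'n ^ 'n"
  assumes "orthogonal_matrix R"
  shows "(\<Sum>j\<in>UNIV. (R $ i $ j)\<^sup>2) = 1" "(\<Sum>i\<in>UNIV. (R $ i $ j)\<^sup>2) = 1"
proof -
  have "(R ** transpose R) $ i $ i = 1" "(transpose R ** R) $ j $ j = 1"
    using assms by (simp_all add: orthogonal_matrix_def mat_def)
  then show "(\<Sum>j\<in>UNIV. (R $ i $ j)\<^sup>2) = 1" "(\<Sum>i\<in>UNIV. (R $ i $ j)\<^sup>2) = 1"
    by (simp_all add: matrix_matrix_mult_def transpose_def power2_eq_square)
qed

section \<open>Quadratic forms and the signs of eigenvalues\<close>

lemma inner_diag_matrix_conjugate:
  "x \<bullet> ((P ** diag_matrix a ** transpose P) *v x) = (\<Sum>i\<in>UNIV. a $ i * ((transpose P *v x) $ i)\<^sup>2)"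
proof -
  have "x \<bullet> ((P ** diag_matrix a ** transpose P) *v x)
    = (transpose P *v x) \<bullet> (diag_matrix a *v (transpose P *v x))"
    by (simp add: inner_matrix_vector_left matrix_vector_mul_assoc matrix_mul_assoc
        del: transpose_matrix_vector)
  then show ?thesis
    by (simp add: inner_vec_def diag_matrix_mult_vector power2_eq_square algebra_simps)
qed

text \<open>The quadratic form at the \<open>i\<close>-th column of \<open>P\<close> reads off
  \<open>a $ i\<close>, so that (semi)definiteness turns into a sign condition on each
  eigenvalue.\<close>

lemma eigenvalue_as_quadratic_form:
  assumes "orthogonal_matrix P"
  shows "(P *v axis i 1) \<bullet> ((P ** diag_matrix a ** transpose P) *v (P *v axis i 1)) = a $ i"
  unfolding inner_diag_matrix_conjugate orthogonal_matrix_cancel[OF assms]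
  by (simp add: axis_def if_distrib[of "\<lambda>y. y ^ 2"] if_distrib[of "\<lambda>y. _ * y"] cong: if_cong)

lemma pos_semidef_eigenvalue_nonneg:
  assumes "orthogonal_matrix P" "pos_semidef (P ** diag_matrix a ** transpose P)"
  shows "0 \<le> a $ i"
  using assms eigenvalue_as_quadratic_form[OF assms(1), where a = a and i = i]
  unfolding pos_semidef_def by metis

lemma pos_def_eigenvalue_pos:
  assumes "orthogonal_matrix P" "pos_def (P ** diag_matrix a ** transpose P)"
  shows "0 < a $ i"
proof -
  have "norm (P *v axis i 1) = 1"
    by (simp add: norm_orthogonal_matrix_mult[OF assms(1)])
  then have "P *v axis i 1 \<noteq> 0"
    by auto
  then show ?thesis
    using assms eigenvalue_as_quadratic_form[OF assms(1), where a = a and i = i]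
    unfolding pos_def_def by metis
qed

section \<open>Existence and uniqueness of the positive semidefinite square root\<close>

lemma pos_semidef_diag_conjugate:
  assumes "\<And>i. 0 \<le> a $ i"
  shows "pos_semidef (P ** diag_matrix a ** transpose P)"
  using assms unfolding pos_semidef_def inner_diag_matrix_conjugate
  by (auto simp: matrix_transpose_mul transpose_diag_matrix matrix_mul_assoc intro!: sum_nonneg)

lemma square_diag_conjugate:
  assumes "orthogonal_matrix P"
  shows "(P ** diag_matrix s ** transpose P) ** (P ** diag_matrix s ** transpose P)
    = P ** diag_matrix (\<chi> i. (s $ i)\<^sup>2) ** transpose P"
proof -
  have "(P ** diag_matrix s ** transpose P) ** (P ** diag_matrix s ** transpose P)
    = P ** (diag_matrix s ** diag_matrix s) ** transpose P"
    by (simp add: matrix_mul_assoc orthogonal_matrix_cancel[OF assms])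
  then show ?thesis
    by (simp add: diag_matrix_mult power2_eq_square)
qed

text \<open>On an eigenvector \<open>p\<close> of \<open>B\<^sup>2\<close> with eigenvalue \<open>s\<^sup>2\<close>, the vector \<open>B p - s p\<close> would be an
  eigenvector of \<open>B\<close> with eigenvalue \<open>-s\<close>.\<close>

lemma pos_semidef_square_eigenvector:
  assumes B: "pos_semidef B" and s: "0 \<le> s" and p: "(B ** B) *v p = s\<^sup>2 *\<^sub>R p"
  shows "B *v p = s *\<^sub>R p"
proof (cases "s = 0")
  \<comment> \<open>With \<open>s = 0\<close> there is no strictly negative eigenvalue to
    contradict; instead \<open>B\<close> being symmetric makes the squared norm of
    \<open>B *v p\<close> equal to the form of \<open>B ** B\<close> at \<open>p\<close>, which is
    \<open>0\<close>.\<close>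
  case True
  have "(B *v p) \<bullet> (B *v p) = p \<bullet> ((B ** B) *v p)"
    using B by (simp add: inner_matrix_vector_left matrix_vector_mul_assoc pos_semidef_def)
  with True p show ?thesis
    by simp
next
  case False
  define w where "w = B *v p - s *\<^sub>R p"
  have "B *v w = - s *\<^sub>R w"
    using p by (simp add: w_def matrix_vector_mult_diff_distrib matrix_vector_mul_assoc
        matrix_vector_mult_scaleR scaleR_diff_right power2_eq_square)
  then have "0 \<le> w \<bullet> (- s *\<^sub>R w)"
    using B by (metis pos_semidef_def)
  then have "s * (w \<bullet> w) \<le> 0"
    by simp
  then have "w \<bullet> w \<le> 0"
    using s False by (simp add: mult_le_0_iff)
  then have "w = 0"
    by (metis inner_gt_zero_iff not_le)
  then show ?thesis
    by (simp add: w_def)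
qed

text \<open>The columns of \<open>P\<close> are eigenvectors of \<open>B ** B\<close>, hence of
  \<open>B\<close> with eigenvalues \<open>s $ i\<close>. Thus \<open>B ** P\<close> and
  \<open>P ** diag_matrix s\<close> agree column by column, and \<open>P\<close> can be
  cancelled.\<close>

lemma pos_semidef_sqrt_unique:
  assumes P: "orthogonal_matrix P" and s: "\<And>i. 0 \<le> s $ i"
    and B: "pos_semidef B" "B ** B = P ** diag_matrix (\<chi> i. (s $ i)\<^sup>2) ** transpose P"
  shows "B = P ** diag_matrix s ** transpose P"
proof -
  have ax: "diag_matrix c *v axis i 1 = c $ i *\<^sub>R axis i 1" for c :: "real ^ 'a" and i
    by (auto simp: vec_eq_iff diag_matrix_mult_vector axis_def)
  have "(B ** B) *v (P *v axis i 1) = (s $ i)\<^sup>2 *\<^sub>R (P *v axis i 1)" for i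
    unfolding B(2) matrix_vector_mul_assoc orthogonal_matrix_cancel[OF P]
    unfolding matrix_vector_mul_assoc[symmetric] ax by (simp add: matrix_vector_mult_scaleR)
  then have "B *v (P *v axis i 1) = s $ i *\<^sub>R (P *v axis i 1)" for i
    by (rule pos_semidef_square_eigenvector[OF B(1) s])
  then have "(B ** P) *v axis i 1 = (P ** diag_matrix s) *v axis i 1" for i
    unfolding matrix_vector_mul_assoc[symmetric] ax by (simp add: matrix_vector_mult_scaleR)
  then have "column i (B ** P) = column i (P ** diag_matrix s)" for i
    by (simp add: matrix_vector_mult_basis)
  then have "B ** P = P ** diag_matrix s"
    by (simp add: column_def vec_eq_iff)
  then show ?thesis
    by (metis orthogonal_matrix_cancel(4)[OF P])
qed

text \<open>Existence and uniqueness together discharge the definite description in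
  \<open>psd_sqrt\<close>.\<close>

lemma psd_sqrt_diag_conjugate:
  assumes P: "orthogonal_matrix P" and a: "\<And>i. 0 \<le> a $ i"
  shows "psd_sqrt (P ** diag_matrix a ** transpose P) = P ** diag_matrix (vec_sqrt a) ** transpose P"
proof -
  have sq: "(\<chi> i. (vec_sqrt a $ i)\<^sup>2) = a"
    using a by (simp add: vec_sqrt_def vec_eq_iff)
  have s: "0 \<le> vec_sqrt a $ i" for i
    using a by (simp add: vec_sqrt_def)
  show ?thesis
    unfolding psd_sqrt_def
  proof (rule the_equality)
    show "pos_semidef (P ** diag_matrix (vec_sqrt a) ** transpose P) \<and>
      (P ** diag_matrix (vec_sqrt a) ** transpose P) ** (P ** diag_matrix (vec_sqrt a) ** transpose P)
      = P ** diag_matrix a ** transpose P"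
      using pos_semidef_diag_conjugate[OF s] square_diag_conjugate[OF P] by (simp add: sq)
  next
    fix B assume "pos_semidef B \<and> B ** B = P ** diag_matrix a ** transpose P"
    then show "B = P ** diag_matrix (vec_sqrt a) ** transpose P"
      using pos_semidef_sqrt_unique[OF P s] by (simp add: sq)
  qed
qed

section \<open>A rearrangement inequality for doubly substochastic matrices\<close>

text \<open>Summation by parts: \<open>g\<close> is the sequence of increments of \<open>f\<close>,
  so \<open>f\<close> becomes a nonnegative combination of indicators of up-sets. The induction adds
  a new largest element \<open>b\<close>, whose increment is \<open>f b\<close> minus the total so
  far.\<close>

lemma mono_nonneg_sum_increments:
  fixes f :: "'a :: linorder \<Rightarrow> real"
  assumes "finite S" "mono_on S f" "\<And>i. i \<in> S \<Longrightarrow> 0 \<le> f i"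
  shows "\<exists>g. (\<forall>k. 0 \<le> g k) \<and> (\<forall>i\<in>S. f i = (\<Sum>k | k \<in> S \<and> k \<le> i. g k))"
  using assms
proof (induction S rule: finite_linorder_max_induct)
  case empty
  show ?case by (rule exI[of _ "\<lambda>_. 0"]) simp
next
  case (insert b S)
  have "mono_on S f"
    using mono_on_subset[OF insert.prems(1) subset_insertI] .
  then have "\<exists>g. (\<forall>k. 0 \<le> g k) \<and> (\<forall>i\<in>S. f i = (\<Sum>k | k \<in> S \<and> k \<le> i. g k))"
    using insert.IH insert.prems(2) by blast
  then obtain g where g: "\<And>k. 0 \<le> g k" "\<And>i. i \<in> S \<Longrightarrow> f i = (\<Sum>k | k \<in> S \<and> k \<le> i. g k)"
    by blast
  \<comment> \<open>The total of the old increments is the value of \<open>f\<close> at the old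
    maximum, so monotonicity makes the new increment nonnegative; for empty \<open>S\<close> this is
    \<open>0 \<le> f b\<close>.\<close>
  have le: "sum g S \<le> f b"
  proof (cases "S = {}")
    case True
    then show ?thesis using insert.prems by simp
  next
    case False
    then have Max: "Max S \<in> S" using insert.hyps by simp
    have "{k. k \<in> S \<and> k \<le> Max S} = S" using insert.hyps by auto
    then have "sum g S = f (Max S)" using g(2)[OF Max] by simp
    also have "\<dots> \<le> f b"
      using insert.prems(1) insert.hyps Max by (auto intro: mono_onD less_imp_le)
    finally show ?thesis .
  qed
  have notin: "b \<notin> S" using insert.hyps by auto
  define h where "h = g(b := f b - sum g S)"
  have hS: "h k = g k" if "k \<in> S" for k
    using that notin by (auto simp: h_def)
  have "f i = (\<Sum>k | k \<in> insert b S \<and> k \<le> i. h k)" if "i \<in> insert b S" for i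
  proof (cases "i = b")
    case True
    have "{k. k \<in> insert b S \<and> k \<le> b} = insert b S" using insert.hyps by auto
    then have "(\<Sum>k | k \<in> insert b S \<and> k \<le> i. h k) = h b + sum h S"
      using True notin insert.hyps by simp
    also have "sum h S = sum g S" using hS by (rule sum.cong[OF refl])
    finally show ?thesis using True by (simp add: h_def)
  next
    case False
    then have i: "i \<in> S" using that by simp
    have "{k. k \<in> insert b S \<and> k \<le> i} = {k. k \<in> S \<and> k \<le> i}"
      using insert.hyps i by fastforce
    then show ?thesis using g(2)[OF i] hS by (auto intro: sum.cong)
  qed
  moreover have "0 \<le> h k" for k using g le by (simp add: h_def)
  ultimately show ?case by blast
qed

text \<open>Splitting \<open>s\<close> and \<open>t\<close> into up-set indicators turns the left
  side into a nonnegative combination of corner sums of \<open>D\<close>. Each corner sum is at most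
  that of the identity matrix, and for the identity matrix the combination is the right
  side.\<close>

lemma substochastic_rearrangement:
  fixes D :: "'n::{finite,linorder} \<Rightarrow> 'n \<Rightarrow> real" and s t :: "'n \<Rightarrow> real"
  assumes D: "\<And>i j. 0 \<le> D i j" "\<And>i. (\<Sum>j\<in>UNIV. D i j) \<le> 1" "\<And>j. (\<Sum>i\<in>UNIV. D i j) \<le> 1"
    and s: "mono s" "\<And>j. 0 \<le> s j" and t: "mono t" "\<And>i. 0 \<le> t i"
  shows "(\<Sum>i\<in>UNIV. \<Sum>j\<in>UNIV. D i j * (t i * s j)) \<le> (\<Sum>j\<in>UNIV. t j * s j)"
proof -
  obtain f where f: "\<And>k. 0 \<le> f k" "\<And>i. t i = (\<Sum>k | k \<le> i. f k)"
    using mono_nonneg_sum_increments[of UNIV t] t by auto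
  obtain g where g: "\<And>k. 0 \<le> g k" "\<And>i. s i = (\<Sum>k | k \<le> i. g k)"
    using mono_nonneg_sum_increments[of UNIV s] s by auto
  have t_eq: "t i = (\<Sum>k\<in>UNIV. f k * of_bool (k \<le> i))" for i
    by (simp add: f(2) sum.If_cases of_bool_def if_distrib[of "\<lambda>y. _ * y"] cong: if_cong)
  have s_eq: "s i = (\<Sum>k\<in>UNIV. g k * of_bool (k \<le> i))" for i
    by (simp add: g(2) sum.If_cases of_bool_def if_distrib[of "\<lambda>y. _ * y"] cong: if_cong)
  \<comment> \<open>Kept general in \<open>E\<close> because it is applied both to \<open>D\<close>
    and, in the opposite direction, to the identity matrix.\<close>
  have layers: "(\<Sum>i\<in>UNIV. \<Sum>j\<in>UNIV. E i j * (t i * s j)) =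
    (\<Sum>k\<in>UNIV. \<Sum>l\<in>UNIV. f k * g l * (\<Sum>i | k \<le> i. \<Sum>j | l \<le> j. E i j))" for E
  proof -
    have "(\<Sum>i\<in>UNIV. \<Sum>j\<in>UNIV. E i j * (t i * s j)) =
      (\<Sum>i\<in>UNIV. \<Sum>j\<in>UNIV. \<Sum>k\<in>UNIV. \<Sum>l\<in>UNIV.
        E i j * ((f k * of_bool (k \<le> i)) * (g l * of_bool (l \<le> j))))"
      unfolding t_eq s_eq sum_product unfolding sum_distrib_left ..
    also have "\<dots> = (\<Sum>i\<in>UNIV. \<Sum>k\<in>UNIV. \<Sum>j\<in>UNIV. \<Sum>l\<in>UNIV.
        E i j * ((f k * of_bool (k \<le> i)) * (g l * of_bool (l \<le> j))))"
      by (intro sum.cong refl sum.swap)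
    also have "\<dots> = (\<Sum>k\<in>UNIV. \<Sum>i\<in>UNIV. \<Sum>l\<in>UNIV. \<Sum>j\<in>UNIV.
        E i j * ((f k * of_bool (k \<le> i)) * (g l * of_bool (l \<le> j))))"
      by (subst sum.swap) (intro sum.cong refl sum.swap)
    also have "\<dots> = (\<Sum>k\<in>UNIV. \<Sum>l\<in>UNIV. \<Sum>i\<in>UNIV. \<Sum>j\<in>UNIV.
        E i j * ((f k * of_bool (k \<le> i)) * (g l * of_bool (l \<le> j))))"
      by (intro sum.cong refl sum.swap)
    also have "\<dots> = (\<Sum>k\<in>UNIV. \<Sum>l\<in>UNIV. f k * g l * (\<Sum>i | k \<le> i. \<Sum>j | l \<le> j. E i j))"
    proof (intro sum.cong refl)
      fix k l
      have inner: "(\<Sum>j\<in>UNIV. E i j * ((f k * of_bool (k \<le> i)) * (g l * of_bool (l \<le> j))))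
          = of_bool (k \<le> i) * (f k * g l * (\<Sum>j | l \<le> j. E i j))" for i
        by (auto simp: sum_distrib_left sum.If_cases of_bool_def if_distrib[of "\<lambda>y. _ * y"]
            algebra_simps cong: if_cong)
      show "(\<Sum>i\<in>UNIV. \<Sum>j\<in>UNIV. E i j * ((f k * of_bool (k \<le> i)) * (g l * of_bool (l \<le> j))))
        = f k * g l * (\<Sum>i | k \<le> i. \<Sum>j | l \<le> j. E i j)"
        unfolding inner sum_distrib_left[of "f k * g l"]
        by (simp add: sum.If_cases of_bool_def if_distrib[of "\<lambda>y. y * _"] cong: if_cong)
    qed
    finally show ?thesis .
  qed
  have corner: "(\<Sum>i | k \<le> i. \<Sum>j | l \<le> j. D i j) \<le> (\<Sum>i | k \<le> i. \<Sum>j | l \<le> j. of_bool (i = j))"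
    for k l
  proof -
    have rhs: "(\<Sum>i | k \<le> i. \<Sum>j | l \<le> j. of_bool (i = j)) = real (card {i. k \<le> i \<and> l \<le> i})"
    proof -
      have "(\<Sum>i | k \<le> i. \<Sum>j | l \<le> j. of_bool (i = j)) = (\<Sum>i | k \<le> i. of_bool (l \<le> i) :: real)"
        by (simp add: of_bool_def)
      also have "\<dots> = real (card ({i. k \<le> i} \<inter> {i. l \<le> i}))"
        by (simp add: of_bool_def sum.If_cases)
      finally show ?thesis by (simp add: Collect_conj_eq)
    qed
    have row: "(\<Sum>i | k \<le> i. \<Sum>j | l \<le> j. D i j) \<le> real (card {i. k \<le> i})"
    proof -
      have "(\<Sum>i | k \<le> i. \<Sum>j | l \<le> j. D i j) \<le> (\<Sum>i | k \<le> i. \<Sum>j\<in>UNIV. D i j)"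
        using D by (intro sum_mono sum_mono2) auto
      also have "\<dots> \<le> (\<Sum>i | k \<le> i. 1)" by (intro sum_mono D)
      finally show ?thesis by simp
    qed
    have col: "(\<Sum>i | k \<le> i. \<Sum>j | l \<le> j. D i j) \<le> real (card {j. l \<le> j})"
    proof -
      have "(\<Sum>i | k \<le> i. \<Sum>j | l \<le> j. D i j) = (\<Sum>j | l \<le> j. \<Sum>i | k \<le> i. D i j)"
        by (rule sum.swap)
      also have "\<dots> \<le> (\<Sum>j | l \<le> j. \<Sum>i\<in>UNIV. D i j)"
        using D by (intro sum_mono sum_mono2) auto
      also have "\<dots> \<le> (\<Sum>j | l \<le> j. 1)" by (intro sum_mono D)
      finally show ?thesis by simp
    qed
    \<comment> \<open>Up-sets of a linear order are nested, so the intersection counted in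
      \<open>rhs\<close> is the smaller of the two; the column bound handles one case and the row
      bound the other.\<close>
    show ?thesis
    proof (cases "k \<le> l")
      case True
      then have "{i. k \<le> i \<and> l \<le> i} = {j. l \<le> j}" by auto
      with col show ?thesis unfolding rhs by simp
    next
      case False
      then have "{i. k \<le> i \<and> l \<le> i} = {j. k \<le> j}" by auto
      with row show ?thesis unfolding rhs by simp
    qed
  qed
  have "(\<Sum>i\<in>UNIV. \<Sum>j\<in>UNIV. D i j * (t i * s j))
    \<le> (\<Sum>k\<in>UNIV. \<Sum>l\<in>UNIV. f k * g l * (\<Sum>i | k \<le> i. \<Sum>j | l \<le> j. of_bool (i = j)))"
    unfolding layers using f g by (intro sum_mono mult_left_mono corner) auto
  also have "\<dots> = (\<Sum>i\<in>UNIV. \<Sum>j\<in>UNIV. of_bool (i = j) * (t i * s j))"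
    unfolding layers ..
  also have "\<dots> = (\<Sum>j\<in>UNIV. t j * s j)"
    by (simp add: of_bool_def if_distrib[of "\<lambda>y. y * _"] cong: if_cong)
  finally show ?thesis .
qed

section \<open>The standard Gaussian\<close>

lemma borel_measurable_matrix_vector_mult [measurable (raw)]:
  fixes A :: "real ^ 'n ^ 'm"
  assumes "X \<in> borel_measurable M"
  shows "(\<lambda>w. A *v X w) \<in> borel_measurable M"
  by (rule measurable_compose[OF assms])
    (intro borel_measurable_continuous_onI linear_continuous_on matrix_vector_mul_bounded_linear)

lemma borel_measurable_vec_nth [measurable (raw)]:
  fixes X :: "'a \<Rightarrow> real ^ 'n"
  assumes [measurable]: "X \<in> borel_measurable M"
  shows "(\<lambda>w. X w $ i) \<in> borel_measurable M"
  unfolding cart_eq_inner_axis by measurable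

section \<open>Invariance of Lebesgue measure under translations and linear isometries\<close>

lemma nn_integral_lborel_translation:
  fixes f :: "'a::euclidean_space \<Rightarrow> ennreal"
  assumes [measurable]: "f \<in> borel_measurable borel"
  shows "(\<integral>\<^sup>+x. f (c + x) \<partial>lborel) = (\<integral>\<^sup>+x. f x \<partial>lborel)"
  by (subst (2) lborel_distr_plus[of c, symmetric]) (simp add: nn_integral_distr)

text \<open>The proof of uniqueness of translation-invariant measures: for \<open>M = distr lborel borel f\<close>
  and the unit ball \<open>B\<close>, Fubini and translations give \<open>M A * lborel B = lborel A * M B\<close>, and
  \<open>M B = lborel B\<close> because \<open>f\<close> preserves the norm.\<close>

lemma lborel_distr_isometry:
  fixes f :: "'a::euclidean_space \<Rightarrow> 'a"
  assumes f: "linear f" "\<And>x. norm (f x) = norm x" and g: "\<And>y. f (g y) = y"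
  shows "distr lborel borel f = lborel"
proof (rule measure_eqI)
  have [measurable]: "f \<in> borel_measurable borel"
    using f(1) by (intro borel_measurable_continuous_onI linear_continuous_on)
      (simp add: linear_conv_bounded_linear)
  fix A assume "A \<in> sets (distr lborel borel f)"
  then have [measurable]: "A \<in> sets borel" by simp
  define B where "B = ball (0::'a) 1"
  have [measurable]: "B \<in> sets borel" by (simp add: B_def)
  have B_f: "indicator B (- f x) = (indicator B x :: ennreal)" for x
    by (simp add: B_def indicator_def f)
  have shift: "f (g y + x) = y + f x" for x y
    by (simp add: linear_add[OF f(1)] g)
  have "emeasure (distr lborel borel f) A * emeasure lborel B
    = (\<integral>\<^sup>+x. indicator A (f x) * emeasure lborel B \<partial>lborel)"
    using nn_integral_distr[of f lborel borel "indicator A"] by (simp add: nn_integral_multc)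
  also have "\<dots> = (\<integral>\<^sup>+x. \<integral>\<^sup>+y. indicator A (f x) * indicator B (y - f x) \<partial>lborel \<partial>lborel)"
  proof (rule nn_integral_cong)
    fix x
    have "(\<integral>\<^sup>+y. indicator B (- f x + y) \<partial>lborel) = emeasure lborel B"
      by (subst nn_integral_lborel_translation) simp_all
    then show "indicator A (f x) * emeasure lborel B
        = (\<integral>\<^sup>+y. indicator A (f x) * indicator B (y - f x) \<partial>lborel)"
      by (simp add: nn_integral_cmult)
  qed
  also have "\<dots> = (\<integral>\<^sup>+y. \<integral>\<^sup>+x. indicator A (f x) * indicator B (y - f x) \<partial>lborel \<partial>lborel)"
    by (rule lborel_pair.Fubini') simp
  \<comment> \<open>Substituting \<open>g y + x\<close> for \<open>x\<close> moves \<open>y\<close>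
    from the factor of \<open>B\<close> to the factor of \<open>A\<close>. Afterwards
    \<open>B_f\<close> frees the factor of \<open>B\<close> from \<open>f\<close>, since the ball is
    symmetric and \<open>f\<close> preserves the norm.\<close>
  also have "\<dots> = (\<integral>\<^sup>+y. \<integral>\<^sup>+x. indicator A (y + f x) * indicator B (- f x) \<partial>lborel \<partial>lborel)"
  proof (rule nn_integral_cong)
    fix y
    show "(\<integral>\<^sup>+x. (indicator A (f x) * indicator B (y - f x) :: ennreal) \<partial>lborel)
        = (\<integral>\<^sup>+x. (indicator A (y + f x) * indicator B (- f x) :: ennreal) \<partial>lborel)"
      by (subst nn_integral_lborel_translation[where c = "g y", symmetric]) (simp_all add: shift)
  qed
  also have "\<dots> = (\<integral>\<^sup>+x. \<integral>\<^sup>+y. indicator A (y + f x) * indicator B x \<partial>lborel \<partial>lborel)"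
    unfolding B_f by (rule lborel_pair.Fubini') simp
  also have "\<dots> = (\<integral>\<^sup>+x. emeasure lborel A * indicator B x \<partial>lborel)"
  proof (rule nn_integral_cong)
    fix x
    have "(\<integral>\<^sup>+y. indicator A (f x + y) \<partial>lborel) = emeasure lborel A"
      by (subst nn_integral_lborel_translation) simp_all
    then show "(\<integral>\<^sup>+y. indicator A (y + f x) * indicator B x \<partial>lborel) = emeasure lborel A * indicator B x"
      by (simp add: nn_integral_multc add.commute)
  qed
  also have "\<dots> = emeasure lborel A * emeasure lborel B"
    by (simp add: nn_integral_cmult)
  finally have "emeasure (distr lborel borel f) A * emeasure lborel B = emeasure lborel A * emeasure lborel B" .
  moreover have "emeasure lborel B \<noteq> 0"
  proof
    assume "emeasure lborel B = 0"
    then have "negligible B"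
      by (auto simp: negligible_iff_null_sets null_sets_completionI null_setsI)
    then show False
      using open_not_negligible[of B] by (simp add: B_def)
  qed
  moreover have "emeasure lborel B \<noteq> \<infinity>"
    using emeasure_bounded_finite[of B] by (auto simp: B_def)
  ultimately show "emeasure (distr lborel borel f) A = emeasure lborel A"
    by (metis ennreal_mult_divide_eq infinity_ennreal_def mult.commute)
qed simp

definition std_gaussian_density :: "real ^ 'n \<Rightarrow> real" where
  "std_gaussian_density z = (\<Prod>i\<in>UNIV. std_normal_density (z $ i))"

lemma std_gaussian_density_nonneg: "0 \<le> std_gaussian_density z"
  unfolding std_gaussian_density_def by (intro prod_nonneg) simp

lemma std_gaussian_density_measurable [measurable]: "std_gaussian_density \<in> borel_measurable borel"
  unfolding std_gaussian_density_def[abs_def] by measurable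

text \<open>The product form of the density lets moments factor; this radial form yields rotation
  invariance.\<close>

lemma std_gaussian_density_norm:
  fixes z :: "real ^ 'n"
  shows "std_gaussian_density z = (1 / sqrt (2 * pi)) ^ CARD('n) * exp (- (norm z)\<^sup>2 / 2)"
proof -
  have "(norm z)\<^sup>2 = (\<Sum>i\<in>UNIV. (z $ i)\<^sup>2)"
    unfolding power2_norm_eq_inner by (simp add: inner_vec_def power2_eq_square)
  then have "(\<Prod>i\<in>UNIV. exp (- (z $ i)\<^sup>2 / 2)) = exp (- (norm z)\<^sup>2 / 2)"
    by (simp add: exp_sum[symmetric] sum_negf sum_divide_distrib[symmetric])
  then show ?thesis
    by (simp add: std_gaussian_density_def std_normal_density_def prod.distrib prod_dividef power_divide)
qed

lemma std_gaussian_eq: "std_gaussian = density lborel (\<lambda>z. ennreal (std_gaussian_density z))"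
  by (simp add: std_gaussian_def std_gaussian_density_def)

lemma sets_std_gaussian [simp, measurable_cong]: "sets std_gaussian = sets borel"
  by (simp add: std_gaussian_def)

lemma space_std_gaussian [simp]: "space std_gaussian = UNIV"
  by (simp add: std_gaussian_def)

lemma std_gaussian_orthogonal:
  fixes \<theta> :: "real ^ 'n ^ 'n"
  assumes "orthogonal_matrix \<theta>"
  shows "distr std_gaussian borel (\<lambda>z. \<theta> *v z) = std_gaussian"
proof -
  have orth: "orthogonal_matrix (transpose \<theta>)" using assms by simp
  \<comment> \<open>\<open>lborel\<close> is replaced by its own image under
    \<open>transpose \<theta>\<close>, which \<open>\<theta>\<close> then undoes. What remains is
    the density composed with \<open>transpose \<theta>\<close>, and that is the density itself
    because it is radial.\<close>
  have "distr std_gaussian borel (\<lambda>z. \<theta> *v z) =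
    distr (density (distr lborel borel (\<lambda>z. transpose \<theta> *v z)) (\<lambda>z. ennreal (std_gaussian_density z)))
      lborel (\<lambda>z. \<theta> *v z)"
    unfolding std_gaussian_eq
    by (subst lborel_distr_isometry[where g = "\<lambda>z. \<theta> *v z"])
      (simp_all add: norm_orthogonal_matrix_mult[OF orth] orthogonal_matrix_cancel[OF assms]
        cong: distr_cong del: transpose_matrix_vector)
  also have "\<dots> = density lborel ((\<lambda>z. ennreal (std_gaussian_density z)) \<circ> (\<lambda>z. transpose \<theta> *v z))"
    by (intro distr_density_distr)
      (simp_all add: orthogonal_matrix_cancel[OF assms] del: transpose_matrix_vector)
  also have "\<dots> = std_gaussian"
    by (simp add: std_gaussian_eq comp_def std_gaussian_density_norm
        norm_orthogonal_matrix_mult[OF orth] del: transpose_matrix_vector)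
  finally show ?thesis .
qed

section \<open>Moments of the standard Gaussian\<close>

lemma lborel_integral_prod:
  fixes h :: "'n::finite \<Rightarrow> real \<Rightarrow> real"
  assumes h: "\<And>i. integrable lborel (h i)"
  shows "integrable lborel (\<lambda>z::real ^ 'n. \<Prod>i\<in>UNIV. h i (z $ i))"
    and "integral\<^sup>L lborel (\<lambda>z::real ^ 'n. (\<Prod>i\<in>UNIV. h i (z $ i))) = (\<Prod>i\<in>UNIV. integral\<^sup>L lborel (h i))"
proof -
  interpret product_sigma_finite "\<lambda>_::real ^ 'n. lborel :: real measure" ..
  \<comment> \<open>\<open>lborel\<close> is an image of the product measure indexed by
    \<open>Basis\<close>, so the factors \<open>h i\<close> are reindexed by basis vectors; the
    choice is unambiguous because \<open>axis i 1\<close> determines \<open>i\<close>.\<close>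
  define k where "k b = h (SOME i. b = axis i 1)" for b :: "real ^ 'n"
  have k_axis: "k (axis i 1) = h i" for i
    by (simp add: k_def axis_eq_axis)
  have Basis: "(Basis :: (real ^ 'n) set) = (\<lambda>i. axis i 1) ` UNIV"
    by (auto simp: Basis_vec_def)
  have inj: "inj (\<lambda>i::'n. axis i (1::real))"
    by (auto simp: inj_on_def axis_eq_axis)
  have [measurable]: "h i \<in> borel_measurable borel" for i
    using h[of i] by auto
  have int: "integrable lborel (k b)" for b
    using h by (simp add: k_def)
  have sum_nth: "(\<Sum>b\<in>Basis. x b *\<^sub>R b) $ i = x (axis i 1)" for x :: "real ^ 'n \<Rightarrow> real" and i
    unfolding Basis sum.reindex[OF inj]
    by (simp add: axis_def if_distrib[of "\<lambda>y. _ * y"] cong: if_cong)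
  have prod: "(\<Prod>i\<in>UNIV. h i ((\<Sum>b\<in>Basis. x b *\<^sub>R b) $ i)) = (\<Prod>b\<in>Basis. k b (x b))"
    for x :: "real ^ 'n \<Rightarrow> real"
    unfolding sum_nth by (simp add: Basis prod.reindex[OF inj] k_axis)
  have [measurable]: "(\<lambda>x. \<Sum>b\<in>Basis. x b *\<^sub>R b) \<in> (\<Pi>\<^sub>M b\<in>(Basis :: (real ^ 'n) set). lborel) \<rightarrow>\<^sub>M borel"
    by measurable
  have "integrable (\<Pi>\<^sub>M b\<in>(Basis :: (real ^ 'n) set). lborel)
      (\<lambda>x. \<Prod>i\<in>UNIV. h i ((\<Sum>b\<in>Basis. x b *\<^sub>R b) $ i))"
    unfolding prod by (intro product_integrable_prod int) simp
  then show "integrable lborel (\<lambda>z::real ^ 'n. \<Prod>i\<in>UNIV. h i (z $ i))"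
    by (subst lborel_eq) (subst integrable_distr_eq, measurable)
  have "integral\<^sup>L (\<Pi>\<^sub>M b\<in>(Basis :: (real ^ 'n) set). lborel)
      (\<lambda>x. \<Prod>i\<in>UNIV. h i ((\<Sum>b\<in>Basis. x b *\<^sub>R b) $ i)) = (\<Prod>i\<in>UNIV. integral\<^sup>L lborel (h i))"
    unfolding prod by (simp add: product_integral_prod int) (simp only: Basis prod.reindex[OF inj] comp_def k_axis)
  moreover have "integral\<^sup>L lborel (\<lambda>z::real ^ 'n. \<Prod>i\<in>UNIV. h i (z $ i)) =
    integral\<^sup>L (\<Pi>\<^sub>M b\<in>(Basis :: (real ^ 'n) set). lborel)
      (\<lambda>x. \<Prod>i\<in>UNIV. h i ((\<Sum>b\<in>Basis. x b *\<^sub>R b) $ i))"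
    by (subst lborel_eq, rule integral_distr) measurable
  ultimately show "integral\<^sup>L lborel (\<lambda>z::real ^ 'n. \<Prod>i\<in>UNIV. h i (z $ i)) = (\<Prod>i\<in>UNIV. integral\<^sup>L lborel (h i))"
    by simp
qed

text \<open>Arbitrary exponents make total mass, means and covariances instances of one
  formula.\<close>

lemma std_gaussian_monomial:
  fixes e :: "'n::finite \<Rightarrow> nat"
  shows "integrable std_gaussian (\<lambda>z::real ^ 'n. \<Prod>i\<in>UNIV. (z $ i) ^ e i)"
    and "integral\<^sup>L std_gaussian (\<lambda>z::real ^ 'n. (\<Prod>i\<in>UNIV. (z $ i) ^ e i))
      = (\<Prod>i\<in>UNIV. \<integral>x. std_normal_density x * x ^ e i \<partial>lborel)"
proof -
  have eq: "std_gaussian_density z * (\<Prod>i\<in>UNIV. (z $ i) ^ e i)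
    = (\<Prod>i\<in>UNIV. std_normal_density (z $ i) * (z $ i) ^ e i)" for z :: "real ^ 'n"
    by (simp add: std_gaussian_density_def prod.distrib)
  note prod = lborel_integral_prod[of "\<lambda>i x. std_normal_density x * x ^ e i",
      OF integrable_std_normal_moment]
  show "integrable std_gaussian (\<lambda>z::real ^ 'n. \<Prod>i\<in>UNIV. (z $ i) ^ e i)"
    unfolding std_gaussian_eq using prod(1)
    by (subst integrable_density) (auto simp: std_gaussian_density_nonneg eq)
  show "integral\<^sup>L std_gaussian (\<lambda>z::real ^ 'n. (\<Prod>i\<in>UNIV. (z $ i) ^ e i))
      = (\<Prod>i\<in>UNIV. \<integral>x. std_normal_density x * x ^ e i \<partial>lborel)"
    unfolding std_gaussian_eq using prod(2)
    by (subst integral_density) (auto simp: std_gaussian_density_nonneg eq)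
qed

lemma std_normal_moments:
  "(\<integral>x. std_normal_density x * x ^ 0 \<partial>lborel) = 1"
  "(\<integral>x. std_normal_density x * x ^ 1 \<partial>lborel) = 0"
  "(\<integral>x. std_normal_density x * x ^ 2 \<partial>lborel) = 1"
  using integral_std_normal_moment_even[of 0] integral_std_normal_moment_odd[of 0]
    integral_std_normal_moment_even[of 1] by (simp_all add: fact_numeral)

lemma prob_space_std_gaussian: "prob_space (std_gaussian :: (real ^ 'n) measure)"
proof
  note m = std_gaussian_monomial[of "\<lambda>_::'n. 0", simplified]
  show "emeasure std_gaussian (space (std_gaussian :: (real ^ 'n) measure)) = 1"
    using nn_integral_eq_integral[OF m(1)] m(2) std_normal_moments(1) by simp
qed

lemma std_gaussian_first_moment:
  "integrable std_gaussian (\<lambda>z::real ^ 'n. z $ k)"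
  "integral\<^sup>L std_gaussian (\<lambda>z::real ^ 'n. z $ k) = 0"
proof -
  have eq: "(\<Prod>i\<in>UNIV. (z $ i) ^ of_bool (i = k)) = z $ k" for z :: "real ^ 'n"
    by (simp add: of_bool_def if_distrib[of "\<lambda>n. _ ^ n"] cong: if_cong)
  note m = std_gaussian_monomial[of "\<lambda>i. of_bool (i = k)", unfolded eq]
  show "integrable std_gaussian (\<lambda>z::real ^ 'n. z $ k)"
    by (rule m)
  have "(\<Prod>i\<in>UNIV. \<integral>x. std_normal_density x * x ^ of_bool (i = k) \<partial>lborel) = 0"
    using std_normal_moments(2) by (intro prod_zero) (auto intro!: exI[of _ k])
  then show "integral\<^sup>L std_gaussian (\<lambda>z::real ^ 'n. z $ k) = 0"
    using m(2) by simp
qed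

lemma std_gaussian_second_moment:
  "integrable std_gaussian (\<lambda>z::real ^ 'n. z $ k * z $ l)"
  "integral\<^sup>L std_gaussian (\<lambda>z::real ^ 'n. z $ k * z $ l) = of_bool (k = l)"
proof -
  \<comment> \<open>The two exponents add up to \<open>2\<close> at \<open>k\<close> when
    \<open>k = l\<close>, so one monomial covers variances and covariances alike.\<close>
  have eq: "(\<Prod>i\<in>UNIV. (z $ i) ^ (of_bool (i = k) + of_bool (i = l))) = z $ k * z $ l"
    for z :: "real ^ 'n"
    by (simp add: power_add prod.distrib of_bool_def if_distrib[of "\<lambda>n. _ ^ n"] cong: if_cong)
  note m = std_gaussian_monomial[of "\<lambda>i. of_bool (i = k) + of_bool (i = l)", unfolded eq]
  show "integrable std_gaussian (\<lambda>z::real ^ 'n. z $ k * z $ l)"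
    by (rule m)
  have "(\<Prod>i\<in>UNIV. \<integral>x. std_normal_density x * x ^ (of_bool (i = k) + of_bool (i = l)) \<partial>lborel)
    = of_bool (k = l)"
  proof (cases "k = l")
    case True
    have "(\<integral>x. std_normal_density x * x ^ (of_bool (i = k) + of_bool (i = l)) \<partial>lborel) = 1" for i
      using std_normal_moments True by (cases "i = l") (simp_all add: numeral_2_eq_2)
    with True show ?thesis by simp
  next
    case False
    then show ?thesis
      using std_normal_moments(2) by (auto intro!: prod_zero exI[of _ k])
  qed
  then show "integral\<^sup>L std_gaussian (\<lambda>z::real ^ 'n. z $ k * z $ l) = of_bool (k = l)"
    using m(2) by simp
qed

section \<open>Correlations of orthogonal families in $L^2$\<close>

text \<open>By the arithmetic-geometric mean inequality, \<open>f * f + g * g\<close> dominates the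
  product.\<close>

lemma integrable_product_of_squares:
  fixes f g :: "'a \<Rightarrow> real"
  assumes [measurable]: "f \<in> borel_measurable M" "g \<in> borel_measurable M"
    and "integrable M (\<lambda>x. f x * f x)" "integrable M (\<lambda>x. g x * g x)"
  shows "integrable M (\<lambda>x. f x * g x)"
proof (rule Bochner_Integration.integrable_bound)
  show "integrable M (\<lambda>x. f x * f x + g x * g x)"
    using assms by simp
  have "\<bar>f x * g x\<bar> \<le> f x * f x + g x * g x" for x
  proof -
    have "2 * (\<bar>f x\<bar> * \<bar>g x\<bar>) \<le> f x * f x + g x * g x"
      using sum_squares_bound[of "\<bar>f x\<bar>" "\<bar>g x\<bar>"] by (simp add: power2_eq_square)
    moreover have "0 \<le> \<bar>f x\<bar> * \<bar>g x\<bar>"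
      by simp
    ultimately show ?thesis
      unfolding abs_mult by linarith
  qed
  then show "AE x in M. norm (f x * g x) \<le> norm (f x * f x + g x * g x)"
    by (intro AE_I2) (metis abs_ge_self order_trans real_norm_def)
qed simp

text \<open>Serves degenerate axes of singular covariances: a coordinate with zero second moment
  vanishes almost everywhere, so all its cross moments vanish.\<close>

lemma integral_mult_eq_0_of_square:
  fixes f g :: "'a \<Rightarrow> real"
  assumes [measurable]: "f \<in> borel_measurable M" "g \<in> borel_measurable M"
    and "integrable M (\<lambda>x. f x * f x)" "(\<integral>x. f x * f x \<partial>M) = 0"
  shows "(\<integral>x. g x * f x \<partial>M) = 0"
proof -
  have "AE x in M. f x * f x = 0"
    using assms by (subst integral_nonneg_eq_0_iff_AE[symmetric]) auto
  then have "AE x in M. g x * f x = 0"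
    by eventually_elim simp
  then show ?thesis
    by (rule integral_eq_zero_AE)
qed

text \<open>Indices with \<open>s j = 0\<close> contribute \<open>0\<close> to the sum, by \<open>x / 0 = 0\<close>.\<close>

lemma Bessel_integral:
  fixes u :: "'n::finite \<Rightarrow> 'a \<Rightarrow> real" and w :: "'a \<Rightarrow> real"
  assumes uu: "\<And>i j. has_bochner_integral M (\<lambda>x. u i x * u j x) (of_bool (i = j) * (s j)\<^sup>2)"
    and wu: "\<And>j. integrable M (\<lambda>x. w x * u j x)"
    and ww: "integrable M (\<lambda>x. w x * w x)"
  shows "(\<Sum>j\<in>UNIV. ((\<integral>x. w x * u j x \<partial>M) / s j)\<^sup>2) \<le> (\<integral>x. w x * w x \<partial>M)"
proof -
  define C where "C j = (\<integral>x. w x * u j x \<partial>M)" for j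
  \<comment> \<open>Coefficient of the orthogonal projection of \<open>w\<close> on
    \<open>u j\<close>, equal to \<open>0\<close> when \<open>s j = 0\<close>. The inequality says
    that the residual has nonnegative second moment.\<close>
  define c where "c j = C j / (s j)\<^sup>2" for j
  have expand: "(w x - (\<Sum>j\<in>UNIV. c j * u j x))\<^sup>2 = w x * w x - 2 * (\<Sum>j\<in>UNIV. c j * (w x * u j x))
      + (\<Sum>i\<in>UNIV. \<Sum>j\<in>UNIV. (c i * c j) * (u i x * u j x))" for x
    by (simp add: power2_eq_square algebra_simps sum_distrib_left sum_distrib_right sum_product)
  have "0 \<le> (\<integral>x. (w x - (\<Sum>j\<in>UNIV. c j * u j x))\<^sup>2 \<partial>M)"
    by simp
  also have "\<dots> = (\<integral>x. w x * w x \<partial>M) - 2 * (\<Sum>j\<in>UNIV. c j * C j)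
      + (\<Sum>i\<in>UNIV. \<Sum>j\<in>UNIV. (c i * c j) * (of_bool (i = j) * (s j)\<^sup>2))"
    unfolding expand C_def using wu ww uu
    by (simp add: has_bochner_integral_iff)
  also have "(\<Sum>i\<in>UNIV. \<Sum>j\<in>UNIV. (c i * c j) * (of_bool (i = j) * (s j)\<^sup>2)) = (\<Sum>j\<in>UNIV. (C j / s j)\<^sup>2)"
    by (simp add: of_bool_def if_distrib[of "\<lambda>y. y * _"] if_distrib[of "\<lambda>y. _ * y"] c_def
        power2_eq_square cong: if_cong) (auto intro: sum.cong)
  also have "(\<Sum>j\<in>UNIV. c j * C j) = (\<Sum>j\<in>UNIV. (C j / s j)\<^sup>2)"
    by (simp add: c_def power2_eq_square)
  finally show ?thesis
    by (simp add: C_def)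
qed

text \<open>Writing \<open>K i j\<close> for the correlation coefficient of \<open>v i\<close> and \<open>u j\<close>, Bessel's inequality makes
  \<open>(K i j)\<^sup>2\<close> doubly substochastic, and \<open>(R i j)\<^sup>2\<close> is doubly stochastic; so their mean, which
  dominates \<open>R i j * K i j\<close>, is doubly substochastic.\<close>

lemma orthogonal_cross_moment_le:
  fixes u v :: "'n::{finite,linorder} \<Rightarrow> 'a \<Rightarrow> real" and R :: "real ^ 'n::{finite,linorder} ^ 'n::{finite,linorder}"
  assumes [measurable]: "\<And>i. u i \<in> borel_measurable M" "\<And>i. v i \<in> borel_measurable M"
    and uu: "\<And>i j. has_bochner_integral M (\<lambda>x. u i x * u j x) (of_bool (i = j) * (s j)\<^sup>2)"
    and vv: "\<And>i j. has_bochner_integral M (\<lambda>x. v i x * v j x) (of_bool (i = j) * (t j)\<^sup>2)"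
    and s: "mono s" "\<And>j. 0 \<le> s j" and t: "mono t" "\<And>i. 0 \<le> t i"
    and R: "orthogonal_matrix R"
  shows "(\<Sum>i\<in>UNIV. \<Sum>j\<in>UNIV. R $ i $ j * (\<integral>x. v i x * u j x \<partial>M)) \<le> (\<Sum>j\<in>UNIV. t j * s j)"
proof -
  define C where "C i j = (\<integral>x. v i x * u j x \<partial>M)" for i j
  define K where "K i j = C i j / (t i * s j)" for i j
  define D where "D i j = ((R $ i $ j)\<^sup>2 + (K i j)\<^sup>2) / 2" for i j
  have sq: "integrable M (\<lambda>x. u j x * u j x)" "(\<integral>x. u j x * u j x \<partial>M) = (s j)\<^sup>2"
    "integrable M (\<lambda>x. v j x * v j x)" "(\<integral>x. v j x * v j x \<partial>M) = (t j)\<^sup>2" for j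
    using uu[of j j] vv[of j j] by (simp_all add: has_bochner_integral_iff)
  have vu: "integrable M (\<lambda>x. v i x * u j x)" for i j
    by (rule integrable_product_of_squares[OF _ _ sq(3) sq(1)]) simp_all
  \<comment> \<open>When \<open>t i\<close> or \<open>s j\<close> is \<open>0\<close>, the quotient
    \<open>K i j\<close> is \<open>0\<close> by convention, so the factorization has to come from
    the vanishing of \<open>C i j\<close>.\<close>
  have C_K: "C i j = K i j * (t i * s j)" for i j
  proof (cases "t i = 0 \<or> s j = 0")
    case True
    then have "C i j = 0"
    proof
      assume "t i = 0"
      have "(\<integral>x. u j x * v i x \<partial>M) = 0"
        by (rule integral_mult_eq_0_of_square[OF _ _ sq(3)]) (simp_all add: sq \<open>t i = 0\<close>)
      then show ?thesis by (simp add: C_def mult.commute)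
    next
      assume "s j = 0"
      show ?thesis
        unfolding C_def by (rule integral_mult_eq_0_of_square[OF _ _ sq(1)]) (simp_all add: sq \<open>s j = 0\<close>)
    qed
    then show ?thesis by (simp add: K_def)
  next
    case False
    then show ?thesis by (simp add: K_def)
  qed
  \<comment> \<open>Bessel's inequality for \<open>v i\<close> against the family \<open>u\<close>,
    divided by the second moment of \<open>v i\<close>; if \<open>t i = 0\<close> the quotient is
    \<open>0\<close>. Columns exchange the two families.\<close>
  have K_row: "(\<Sum>j\<in>UNIV. (K i j)\<^sup>2) \<le> 1" for i
  proof -
    have "(\<Sum>j\<in>UNIV. (C i j / s j)\<^sup>2) \<le> (t i)\<^sup>2"
      unfolding C_def using Bessel_integral[OF uu vu sq(3)] by (simp add: sq)
    moreover have "(\<Sum>j\<in>UNIV. (K i j)\<^sup>2) = (\<Sum>j\<in>UNIV. (C i j / s j)\<^sup>2) / (t i)\<^sup>2"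
      by (simp add: K_def sum_divide_distrib power_divide power_mult_distrib mult.commute)
    ultimately show ?thesis
      by (simp add: divide_le_eq_1)
  qed
  have K_col: "(\<Sum>i\<in>UNIV. (K i j)\<^sup>2) \<le> 1" for j
  proof -
    have "integrable M (\<lambda>x. u j x * v i x)" for i
      using vu by (simp add: mult.commute)
    then have "(\<Sum>i\<in>UNIV. (C i j / t i)\<^sup>2) \<le> (s j)\<^sup>2"
      unfolding C_def using Bessel_integral[OF vv _ sq(1)] by (simp add: sq mult.commute)
    moreover have "(\<Sum>i\<in>UNIV. (K i j)\<^sup>2) = (\<Sum>i\<in>UNIV. (C i j / t i)\<^sup>2) / (s j)\<^sup>2"
      by (simp add: K_def sum_divide_distrib power_divide power_mult_distrib)
    ultimately show ?thesis
      by (simp add: divide_le_eq_1)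
  qed
  have "R $ i $ j * C i j \<le> D i j * (t i * s j)" for i j
  proof -
    have "R $ i $ j * K i j \<le> D i j"
      using sum_squares_bound[of "R $ i $ j" "K i j"] by (simp add: D_def)
    then have "(R $ i $ j * K i j) * (t i * s j) \<le> D i j * (t i * s j)"
      using s t by (intro mult_right_mono) auto
    then show ?thesis by (simp add: C_K mult.assoc)
  qed
  then have "(\<Sum>i\<in>UNIV. \<Sum>j\<in>UNIV. R $ i $ j * C i j) \<le> (\<Sum>i\<in>UNIV. \<Sum>j\<in>UNIV. D i j * (t i * s j))"
    by (intro sum_mono)
  also have "\<dots> \<le> (\<Sum>j\<in>UNIV. t j * s j)"
  proof (rule substochastic_rearrangement)
    show "0 \<le> D i j" for i j by (simp add: D_def)
    have D_row: "(\<Sum>j\<in>UNIV. D i j) = ((\<Sum>j\<in>UNIV. (R $ i $ j)\<^sup>2) + (\<Sum>j\<in>UNIV. (K i j)\<^sup>2)) / 2" for i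
      by (simp add: D_def sum_divide_distrib[symmetric] sum.distrib)
    show "(\<Sum>j\<in>UNIV. D i j) \<le> 1" for i
      using K_row[of i] D_row[of i] by (simp add: orthogonal_matrix_sum_squares[OF R])
    have D_col: "(\<Sum>i\<in>UNIV. D i j) = ((\<Sum>i\<in>UNIV. (R $ i $ j)\<^sup>2) + (\<Sum>i\<in>UNIV. (K i j)\<^sup>2)) / 2" for j
      by (simp add: D_def sum_divide_distrib[symmetric] sum.distrib)
    show "(\<Sum>i\<in>UNIV. D i j) \<le> 1" for j
      using K_col[of j] D_col[of j] by (simp add: orthogonal_matrix_sum_squares[OF R])
  qed (use s t in auto)
  finally show ?thesis
    by (simp add: C_def)
qed

section \<open>Transport between laws with given principal axes\<close>

text \<open>The columns of \<open>Q\<close> are principal axes of \<open>\<mu>\<close> and the entries of \<open>s\<close> the standard deviations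
  along them; the moments are not centered.\<close>

definition has_principal_axes ::
  "(real ^ 'n) measure \<Rightarrow> real ^ 'n ^ 'n \<Rightarrow> real ^ 'n \<Rightarrow> bool" where
  "has_principal_axes \<mu> Q s \<longleftrightarrow> orthogonal_matrix Q \<and>
    (\<forall>i j. has_bochner_integral \<mu> (\<lambda>x. (transpose Q *v x) $ i * (transpose Q *v x) $ j)
      (of_bool (i = j) * (s $ j)\<^sup>2))"

text \<open>Carries the moments of a law back to the space where \<open>X\<close> lives, so that
  both marginals can be compared under one measure.\<close>

lemma has_principal_axes_distr:
  assumes "X \<in> borel_measurable M" "has_principal_axes (distr M borel X) Q s"
  shows "has_bochner_integral M (\<lambda>w. (transpose Q *v X w) $ i * (transpose Q *v X w) $ j)
    (of_bool (i = j) * (s $ j)\<^sup>2)"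
proof -
  have m: "(\<lambda>x. (transpose Q *v x) $ i * (transpose Q *v x) $ j) \<in> borel_measurable borel"
    by measurable
  show ?thesis
    using assms(2) unfolding has_principal_axes_def has_bochner_integral_iff
      integrable_distr_eq[OF assms(1) m, symmetric] integral_distr[OF assms(1) m, symmetric]
    by blast
qed

text \<open>Passing to the principal frames preserves both norms, and the inner product acquires the
  change of frame \<open>transpose P ** Q\<close> as its matrix. Random variables on a common
  \<open>M\<close> cover couplings (the two projections) as well as transport maps (the identity and
  \<open>T\<close>).\<close>

lemma transport_cost_expansion:
  assumes [measurable]: "X \<in> borel_measurable M" "Y \<in> borel_measurable M"
    and X: "has_principal_axes (distr M borel X) Q s" and Y: "has_principal_axes (distr M borel Y) P t"
  shows "(\<integral>\<^sup>+w. ennreal ((norm (X w - Y w))\<^sup>2) \<partial>M) = ennreal ((\<Sum>j\<in>UNIV. (s $ j)\<^sup>2) + (\<Sum>j\<in>UNIV. (t $ j)\<^sup>2)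
    - 2 * (\<Sum>i\<in>UNIV. \<Sum>j\<in>UNIV. (transpose P ** Q) $ i $ j *
        (\<integral>w. (transpose P *v Y w) $ i * (transpose Q *v X w) $ j \<partial>M)))"
proof -
  define u where "u j w = (transpose Q *v X w) $ j" for j w
  define v where "v j w = (transpose P *v Y w) $ j" for j w
  have PQ: "orthogonal_matrix P" "orthogonal_matrix Q"
    using X Y by (simp_all add: has_principal_axes_def)
  have [measurable]: "u j \<in> borel_measurable M" "v j \<in> borel_measurable M" for j
    unfolding u_def[abs_def] v_def[abs_def] by measurable
  have sq: "integrable M (\<lambda>w. u j w * u j w)" "(\<integral>w. u j w * u j w \<partial>M) = (s $ j)\<^sup>2"
    "integrable M (\<lambda>w. v j w * v j w)" "(\<integral>w. v j w * v j w \<partial>M) = (t $ j)\<^sup>2" for j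
    using has_principal_axes_distr[OF _ X, of j j] has_principal_axes_distr[OF _ Y, of j j]
    by (simp_all add: has_bochner_integral_iff u_def v_def del: transpose_matrix_vector)
  have vu: "integrable M (\<lambda>w. v i w * u j w)" for i j
    by (rule integrable_product_of_squares[OF _ _ sq(3) sq(1)]) simp_all
  have expand: "(norm (X w - Y w))\<^sup>2 = (\<Sum>j\<in>UNIV. u j w * u j w) + (\<Sum>j\<in>UNIV. v j w * v j w)
    - 2 * (\<Sum>i\<in>UNIV. \<Sum>j\<in>UNIV. (transpose P ** Q) $ i $ j * (v i w * u j w))" for w
  proof -
    have "X w \<bullet> X w = (transpose Q *v X w) \<bullet> (transpose Q *v X w)"
      by (simp add: inner_matrix_vector_left orthogonal_matrix_cancel[OF PQ(2)] del: transpose_matrix_vector)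
    then have XX: "X w \<bullet> X w = (\<Sum>j\<in>UNIV. u j w * u j w)"
      by (simp add: inner_vec_def u_def del: transpose_matrix_vector)
    have "Y w \<bullet> Y w = (transpose P *v Y w) \<bullet> (transpose P *v Y w)"
      by (simp add: inner_matrix_vector_left orthogonal_matrix_cancel[OF PQ(1)] del: transpose_matrix_vector)
    then have YY: "Y w \<bullet> Y w = (\<Sum>j\<in>UNIV. v j w * v j w)"
      by (simp add: inner_vec_def v_def del: transpose_matrix_vector)
    have "Y w \<bullet> X w = (transpose P *v Y w) \<bullet> ((transpose P ** Q) *v (transpose Q *v X w))"
      by (simp add: inner_matrix_vector_left orthogonal_matrix_cancel[OF PQ(1)]
          orthogonal_matrix_cancel[OF PQ(2)] matrix_vector_mul_assoc[symmetric] del: transpose_matrix_vector)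
    also have "\<dots> = (\<Sum>i\<in>UNIV. v i w * (\<Sum>j\<in>UNIV. (transpose P ** Q) $ i $ j * u j w))"
      unfolding inner_vec_def matrix_vector_mult_def[of "transpose P ** Q"] by (simp add: u_def v_def
        del: transpose_matrix_vector)
    finally have YX: "Y w \<bullet> X w = (\<Sum>i\<in>UNIV. \<Sum>j\<in>UNIV. (transpose P ** Q) $ i $ j * (v i w * u j w))"
      by (simp add: sum_distrib_left algebra_simps)
    show ?thesis
      unfolding power2_norm_eq_inner XX[symmetric] YY[symmetric] YX[symmetric]
      by (simp add: inner_diff_left inner_diff_right inner_commute)
  qed
  have int: "integrable M (\<lambda>w. (norm (X w - Y w))\<^sup>2)"
    unfolding expand using vu sq by (intro Bochner_Integration.integrable_diff
        Bochner_Integration.integrable_add Bochner_Integration.integrable_sum integrable_mult_right) auto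
  have "(\<integral>w. (norm (X w - Y w))\<^sup>2 \<partial>M) = (\<Sum>j\<in>UNIV. (s $ j)\<^sup>2) + (\<Sum>j\<in>UNIV. (t $ j)\<^sup>2)
    - 2 * (\<Sum>i\<in>UNIV. \<Sum>j\<in>UNIV. (transpose P ** Q) $ i $ j * (\<integral>w. v i w * u j w \<partial>M))"
    unfolding expand using vu sq by simp
  then show ?thesis
    using nn_integral_eq_integral[OF int] by (simp add: u_def v_def del: transpose_matrix_vector)
qed

lemma sum_square_diff:
  fixes s t :: "real ^ 'n"
  shows "(\<Sum>j\<in>UNIV. (s $ j - t $ j)\<^sup>2)
    = (\<Sum>j\<in>UNIV. (s $ j)\<^sup>2) + (\<Sum>j\<in>UNIV. (t $ j)\<^sup>2) - 2 * (\<Sum>j\<in>UNIV. t $ j * s $ j)"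
  by (simp add: power2_diff sum.distrib sum_subtractf sum_distrib_left algebra_simps)

text \<open>Only second moments enter, and the two frames may be in any relative position. The same
  bound therefore serves every orthogonal image of the source at once.\<close>

lemma W2_sq_principal_axes_ge:
  fixes s t :: "real ^ 'n::{finite,linorder}"
  assumes \<mu>: "has_principal_axes \<mu> Q s" and \<nu>: "has_principal_axes \<nu> P t"
    and s: "mono (($) s)" "\<And>j. 0 \<le> s $ j" and t: "mono (($) t)" "\<And>j. 0 \<le> t $ j"
  shows "ennreal (\<Sum>j\<in>UNIV. (s $ j - t $ j)\<^sup>2) \<le> W2_sq \<mu> \<nu>"
  unfolding W2_sq_def
proof (rule INF_greatest)
  fix \<pi> assume "\<pi> \<in> couplings \<mu> \<nu>"
  then have sets: "sets \<pi> = sets (borel \<Otimes>\<^sub>M borel)" and fst: "distr \<pi> borel fst = \<mu>"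
    and snd: "distr \<pi> borel snd = \<nu>"
    by (auto simp: couplings_def)
  have fs [measurable]: "fst \<in> borel_measurable \<pi>" "snd \<in> borel_measurable \<pi>"
    by (simp_all cong: measurable_cong_sets add: measurable_cong_sets[OF sets refl])
  note X = \<mu>[folded fst] and Y = \<nu>[folded snd]
  have R: "orthogonal_matrix (transpose P ** Q)"
    using \<mu> \<nu> by (simp add: has_principal_axes_def orthogonal_matrix_mul)
  have "(\<Sum>i\<in>UNIV. \<Sum>j\<in>UNIV. (transpose P ** Q) $ i $ j *
      (\<integral>w. (transpose P *v snd w) $ i * (transpose Q *v fst w) $ j \<partial>\<pi>)) \<le> (\<Sum>j\<in>UNIV. t $ j * s $ j)"
    by (rule orthogonal_cross_moment_le[OF _ _ has_principal_axes_distr[OF fs(1) X]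
          has_principal_axes_distr[OF fs(2) Y] s t R]) measurable
  then show "ennreal (\<Sum>j\<in>UNIV. (s $ j - t $ j)\<^sup>2) \<le> (\<integral>\<^sup>+ (x, y). ennreal ((norm (x - y))\<^sup>2) \<partial>\<pi>)"
    using transport_cost_expansion[OF fs X Y]
    by (simp add: case_prod_beta' sum_square_diff ennreal_leI del: transpose_matrix_vector)
qed

text \<open>Equality in the transport cost forces equality in the Cauchy--Schwarz inequality along each
  principal axis.\<close>

lemma optimal_transport_map_components:
  fixes s t :: "real ^ 'n"
  assumes \<mu>: "has_principal_axes \<mu> P s" "sets \<mu> = sets borel" and \<nu>: "has_principal_axes (distr \<mu> borel T) P t"
    and [measurable]: "T \<in> borel_measurable borel"
    and s: "\<And>j. 0 < s $ j" and t: "\<And>j. 0 \<le> t $ j"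
    and cost: "(\<integral>\<^sup>+x. ennreal ((norm (x - T x))\<^sup>2) \<partial>\<mu>) \<le> ennreal (\<Sum>j\<in>UNIV. (s $ j - t $ j)\<^sup>2)"
  shows "AE x in \<mu>. \<forall>j. (transpose P *v T x) $ j = t $ j / s $ j * (transpose P *v x) $ j"
proof -
  define u where "u j w = (transpose P *v w) $ j" for j w
  define v where "v j w = (transpose P *v T w) $ j" for j w
  have P: "orthogonal_matrix P"
    using \<mu> by (simp add: has_principal_axes_def)
  have [measurable_cong]: "sets \<mu> = sets borel" by fact
  have T: "T \<in> borel_measurable \<mu>" by measurable
  \<comment> \<open>The source is viewed as the law of the identity, so that the map
    \<open>T\<close> and the identity form a pair of random variables on
    \<open>\<mu>\<close>.\<close>
  have id: "distr \<mu> borel (\<lambda>x. x) = \<mu>"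
    using \<mu>(2) by (rule distr_id2[OF sym])
  have id_m: "(\<lambda>x. x) \<in> borel_measurable \<mu>" by measurable
  have X: "has_principal_axes (distr \<mu> borel (\<lambda>x. x)) P s"
    using \<mu>(1) by (simp only: id)
  note Y = \<nu>
  have [measurable]: "u j \<in> borel_measurable \<mu>" "v j \<in> borel_measurable \<mu>" for j
    unfolding u_def[abs_def] v_def[abs_def] by measurable
  have uu: "has_bochner_integral \<mu> (\<lambda>w. u i w * u j w) (of_bool (i = j) * (s $ j)\<^sup>2)" for i j
    using has_principal_axes_distr[OF id_m X] by (simp add: u_def)
  have sq: "integrable \<mu> (\<lambda>w. u j w * u j w)" "(\<integral>w. u j w * u j w \<partial>\<mu>) = (s $ j)\<^sup>2"
    "integrable \<mu> (\<lambda>w. v j w * v j w)" "(\<integral>w. v j w * v j w \<partial>\<mu>) = (t $ j)\<^sup>2" for j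
    using uu[of j j] has_principal_axes_distr[OF T Y, of j j]
    by (simp_all add: has_bochner_integral_iff v_def del: transpose_matrix_vector)
  define C where "C i j = (\<integral>w. v i w * u j w \<partial>\<mu>)" for i j
  have vu: "integrable \<mu> (\<lambda>w. v i w * u j w)" for i j
    by (rule integrable_product_of_squares[OF _ _ sq(3) sq(1)]) simp_all
  \<comment> \<open>Cauchy--Schwarz on axis \<open>j\<close>, obtained by keeping a single term of
    Bessel's inequality.\<close>
  have C_le: "C j j \<le> t $ j * s $ j" for j
  proof -
    have "(C j j / s $ j)\<^sup>2 \<le> (\<Sum>k\<in>UNIV. (C j k / s $ k)\<^sup>2)"
      by (rule member_le_sum) auto
    also have "\<dots> \<le> (t $ j)\<^sup>2"
      unfolding C_def using Bessel_integral[OF uu vu sq(3)] by (simp add: sq)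
    finally have "C j j / s $ j \<le> t $ j"
      using t by (rule power2_le_imp_le)
    then show ?thesis
      using s[of j] by (simp add: pos_divide_le_eq)
  qed
  \<comment> \<open>Both laws share the frame \<open>P\<close>, so the change of frame is the
    identity and only diagonal cross moments contribute to the cost.\<close>
  have "(\<Sum>i\<in>UNIV. \<Sum>j\<in>UNIV. (transpose P ** P) $ i $ j * C i j) = (\<Sum>j\<in>UNIV. C j j)"
    by (simp add: orthogonal_matrix_cancel[OF P] mat_def if_distrib[of "\<lambda>y. y * _"] cong: if_cong)
  then have "ennreal ((\<Sum>j\<in>UNIV. (s $ j)\<^sup>2) + (\<Sum>j\<in>UNIV. (t $ j)\<^sup>2) - 2 * (\<Sum>j\<in>UNIV. C j j))
    \<le> ennreal (\<Sum>j\<in>UNIV. (s $ j - t $ j)\<^sup>2)"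
    using cost transport_cost_expansion[OF id_m T X Y]
    by (simp add: C_def u_def v_def del: transpose_matrix_vector)
  then have "(\<Sum>j\<in>UNIV. (s $ j)\<^sup>2) + (\<Sum>j\<in>UNIV. (t $ j)\<^sup>2) - 2 * (\<Sum>j\<in>UNIV. C j j)
    \<le> (\<Sum>j\<in>UNIV. (s $ j - t $ j)\<^sup>2)"
    by (subst (asm) ennreal_le_iff) (auto intro: sum_nonneg)
  then have "(\<Sum>j\<in>UNIV. t $ j * s $ j - C j j) \<le> 0"
    by (simp add: sum_square_diff sum_subtractf)
  then have "(\<Sum>j\<in>UNIV. t $ j * s $ j - C j j) = 0"
    using C_le by (intro antisym sum_nonneg) auto
  then have C_eq: "C j j = t $ j * s $ j" for j
    using C_le by (subst (asm) sum_nonneg_eq_0_iff) auto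
  have "AE x in \<mu>. v j x = t $ j / s $ j * u j x" for j
  proof -
    \<comment> \<open>Regression coefficient of \<open>v j\<close> on \<open>u j\<close>; with
      equality in Cauchy--Schwarz the residual has zero second moment.\<close>
    define c where "c = t $ j / s $ j"
    have expand: "(v j x - c * u j x)\<^sup>2 = v j x * v j x - 2 * c * (v j x * u j x) + c\<^sup>2 * (u j x * u j x)" for x
      by (simp add: power2_eq_square algebra_simps)
    have "(\<integral>x. (v j x - c * u j x)\<^sup>2 \<partial>\<mu>) = (t $ j)\<^sup>2 - 2 * c * C j j + c\<^sup>2 * (s $ j)\<^sup>2"
      unfolding expand C_def using sq vu by simp
    also have "\<dots> = 0"
      using s[of j] by (simp add: C_eq c_def power2_eq_square)
    finally have zero: "(\<integral>x. (v j x - c * u j x)\<^sup>2 \<partial>\<mu>) = 0" .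
    have "integrable \<mu> (\<lambda>x. (v j x - c * u j x)\<^sup>2)"
      unfolding expand using sq vu by simp
    from integral_nonneg_eq_0_iff_AE[OF this] zero
    have "AE x in \<mu>. (v j x - c * u j x)\<^sup>2 = 0"
      by simp
    then show ?thesis
      unfolding c_def[symmetric] by eventually_elim simp
  qed
  then show ?thesis
    by (simp add: AE_all_countable u_def v_def del: transpose_matrix_vector)
qed

section \<open>Gaussian measures\<close>

lemma std_gaussian_mean: "has_bochner_integral std_gaussian (\<lambda>z::real ^ 'n. z) 0"
proof -
  have "has_bochner_integral std_gaussian (\<lambda>z::real ^ 'n. z $ k *\<^sub>R axis k (1::real)) (0 *\<^sub>R axis k (1::real))" for k :: 'n
    by (intro has_bochner_integral_scaleR_left)
      (simp add: has_bochner_integral_iff std_gaussian_first_moment)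
  then have "has_bochner_integral std_gaussian (\<lambda>z::real ^ 'n. \<Sum>k\<in>UNIV. z $ k *\<^sub>R axis k (1::real))
      (\<Sum>k\<in>(UNIV :: 'n set). 0)"
    by (intro has_bochner_integral_sum) simp
  moreover have "(\<Sum>k\<in>UNIV. z $ k *\<^sub>R axis k (1::real)) = z" for z :: "real ^ 'n"
    using basis_expansion[of z] by (simp add: scalar_mult_eq_scaleR)
  ultimately show ?thesis
    by simp
qed

text \<open>A linear image of the standard Gaussian has mean \<open>0\<close>, so the mean of the
  law is exactly the shift \<open>m\<close> that centering removes.\<close>

lemma centered_multivariate_normal:
  "centered (multivariate_normal m S) = multivariate_normal 0 S"
proof -
  interpret prob_space "std_gaussian :: (real ^ 'a) measure"
    by (rule prob_space_std_gaussian)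
  have "has_bochner_integral std_gaussian (\<lambda>z. psd_sqrt S *v z) (psd_sqrt S *v 0)"
    by (intro has_bochner_integral_bounded_linear[OF matrix_vector_mul_bounded_linear] std_gaussian_mean)
  then have "has_bochner_integral std_gaussian (\<lambda>z. m + psd_sqrt S *v z) (m + 0)"
    by (intro has_bochner_integral_add) (simp_all add: has_bochner_integral_iff prob_space[simplified])
  then have "(\<integral>y. y \<partial>multivariate_normal m S) = m"
    by (simp add: multivariate_normal_def integral_distr has_bochner_integral_iff)
  then show ?thesis
    by (simp add: centered_def multivariate_normal_def distr_distr comp_def)
qed

text \<open>By rotation invariance of the standard Gaussian, the square root of the covariance may be
  replaced by \<open>Q ** diag_matrix (vec_sqrt a)\<close>.\<close>

lemma multivariate_normal_diag_conjugate:
  fixes Q :: "real ^ 'n ^ 'n"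
  assumes Q: "orthogonal_matrix Q" and a: "\<And>i. 0 \<le> a $ i"
  shows "multivariate_normal 0 (Q ** diag_matrix a ** transpose Q)
    = distr std_gaussian borel (\<lambda>z. Q *v (diag_matrix (vec_sqrt a) *v z))"
proof -
  have "multivariate_normal 0 (Q ** diag_matrix a ** transpose Q)
    = distr std_gaussian borel (\<lambda>z. Q *v (diag_matrix (vec_sqrt a) *v (transpose Q *v z)))"
    by (simp add: multivariate_normal_def psd_sqrt_diag_conjugate[OF Q a] matrix_vector_mul_assoc
        matrix_mul_assoc         del: transpose_matrix_vector)
  also have "\<dots> = distr (distr std_gaussian borel (\<lambda>z. transpose Q *v z)) borel
      (\<lambda>z. Q *v (diag_matrix (vec_sqrt a) *v z))"
    by (subst distr_distr) (simp_all add: comp_def del: transpose_matrix_vector)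
  also have "\<dots> = distr std_gaussian borel (\<lambda>z. Q *v (diag_matrix (vec_sqrt a) *v z))"
    using Q by (simp add: std_gaussian_orthogonal del: transpose_matrix_vector)
  finally show ?thesis .
qed

text \<open>An orthogonal map rotates the frame and keeps the eigenvalues, so varying
  \<open>\<theta>\<close> amounts to varying the frame of the source.\<close>

lemma pushforward_multivariate_normal:
  fixes \<theta> Q :: "real ^ 'n ^ 'n"
  assumes "orthogonal_matrix \<theta>" "orthogonal_matrix Q" "\<And>i. 0 \<le> a $ i"
  shows "pushforward_matrix \<theta> (multivariate_normal 0 (Q ** diag_matrix a ** transpose Q))
    = multivariate_normal 0 ((\<theta> ** Q) ** diag_matrix a ** transpose (\<theta> ** Q))"
  using assms
  by (simp add: multivariate_normal_diag_conjugate orthogonal_matrix_mul pushforward_matrix_def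
      distr_distr comp_def matrix_vector_mul_assoc matrix_mul_assoc)

text \<open>Connects Gaussians to the second-moment results: along the columns of \<open>Q\<close>
  the coordinates are multiples of uncorrelated standard ones.\<close>

lemma multivariate_normal_principal_axes:
  fixes Q :: "real ^ 'n ^ 'n"
  assumes Q: "orthogonal_matrix Q" and a: "\<And>i. 0 \<le> a $ i"
  shows "has_principal_axes (multivariate_normal 0 (Q ** diag_matrix a ** transpose Q)) Q (vec_sqrt a)"
proof -
  have eq: "(transpose Q *v (Q *v (diag_matrix (vec_sqrt a) *v z))) $ i = vec_sqrt a $ i * z $ i" for z i
    by (simp add: orthogonal_matrix_cancel[OF Q] diag_matrix_mult_vector del: transpose_matrix_vector)
  have "has_bochner_integral std_gaussian
      (\<lambda>z. (vec_sqrt a $ i * z $ i) * (vec_sqrt a $ j * z $ j)) (of_bool (i = j) * (vec_sqrt a $ j)\<^sup>2)" for i j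
  proof -
    have "has_bochner_integral std_gaussian (\<lambda>z. (vec_sqrt a $ i * vec_sqrt a $ j) * (z $ i * z $ j))
        ((vec_sqrt a $ i * vec_sqrt a $ j) * of_bool (i = j))"
      by (intro has_bochner_integral_mult_right)
        (simp add: has_bochner_integral_iff std_gaussian_second_moment)
    moreover have "(vec_sqrt a $ i * vec_sqrt a $ j) * (z $ i * z $ j)
        = (vec_sqrt a $ i * z $ i) * (vec_sqrt a $ j * z $ j)" for z :: "real ^ 'n"
      by (simp add: mult_ac)
    moreover have "(vec_sqrt a $ i * vec_sqrt a $ j) * of_bool (i = j) = of_bool (i = j) * (vec_sqrt a $ j)\<^sup>2"
      by (simp add: power2_eq_square)
    ultimately show ?thesis
      by (simp only:)
  qed
  then show ?thesis
    unfolding has_principal_axes_def multivariate_normal_diag_conjugate[OF assms] has_bochner_integral_iff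
    by (simp add: Q integrable_distr_eq integral_distr eq del: transpose_matrix_vector)
qed

section \<open>Optimal coupling and optimal map for Gaussians with a common eigenbasis\<close>

lemma gaussian_coupling_cost:
  fixes P :: "real ^ 'n ^ 'n"
  assumes "orthogonal_matrix P"
  shows "(\<integral>\<^sup>+z. ennreal ((norm (P *v (diag_matrix s *v z) - P *v (diag_matrix t *v z)))\<^sup>2) \<partial>std_gaussian)
    = ennreal (\<Sum>j\<in>UNIV. (s $ j - t $ j)\<^sup>2)"
proof -
  have eq: "(norm (P *v (diag_matrix s *v z) - P *v (diag_matrix t *v z)))\<^sup>2
    = (\<Sum>j\<in>UNIV. (s $ j - t $ j)\<^sup>2 * (z $ j * z $ j))" for z
  proof -
    have "norm (P *v (diag_matrix s *v z) - P *v (diag_matrix t *v z))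
      = norm (diag_matrix s *v z - diag_matrix t *v z)"
      by (simp add: matrix_vector_mult_diff_distrib[symmetric] norm_orthogonal_matrix_mult[OF assms])
    then show ?thesis
      by (simp only: power2_norm_eq_inner)
        (simp add: inner_vec_def diag_matrix_mult_vector power2_eq_square algebra_simps)
  qed
  have "integrable std_gaussian (\<lambda>z. \<Sum>j\<in>UNIV. (s $ j - t $ j)\<^sup>2 * (z $ j * z $ j))"
    by (intro Bochner_Integration.integrable_sum integrable_mult_right std_gaussian_second_moment)
  then have "(\<integral>\<^sup>+z. ennreal (\<Sum>j\<in>UNIV. (s $ j - t $ j)\<^sup>2 * (z $ j * z $ j)) \<partial>std_gaussian)
    = ennreal (\<integral>z. (\<Sum>j\<in>UNIV. (s $ j - t $ j)\<^sup>2 * (z $ j * z $ j)) \<partial>std_gaussian)"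
    by (intro nn_integral_eq_integral AE_I2 sum_nonneg) simp_all
  then show ?thesis
    by (simp add: eq std_gaussian_second_moment)
qed

text \<open>The coupling drives both Gaussians by the same standard Gaussian \<open>z\<close>, so
  that on each common axis the two coordinates are multiples of \<open>z $ j\<close>.\<close>

lemma W2_sq_multivariate_normal_aligned_le:
  fixes P :: "real ^ 'n ^ 'n"
  assumes P: "orthogonal_matrix P" and a: "\<And>i. 0 \<le> a $ i" and b: "\<And>i. 0 \<le> b $ i"
  shows "W2_sq (multivariate_normal 0 (P ** diag_matrix a ** transpose P))
      (multivariate_normal 0 (P ** diag_matrix b ** transpose P))
    \<le> ennreal (\<Sum>j\<in>UNIV. (vec_sqrt a $ j - vec_sqrt b $ j)\<^sup>2)"
proof -
  define X where "X z = P *v (diag_matrix (vec_sqrt a) *v z)" for z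
  define Y where "Y z = P *v (diag_matrix (vec_sqrt b) *v z)" for z
  have [measurable]: "X \<in> borel_measurable borel" "Y \<in> borel_measurable borel"
    unfolding X_def[abs_def] Y_def[abs_def] by measurable
  define \<pi> where "\<pi> = distr std_gaussian (borel \<Otimes>\<^sub>M borel) (\<lambda>z. (X z, Y z))"
  have "\<pi> \<in> couplings (multivariate_normal 0 (P ** diag_matrix a ** transpose P))
      (multivariate_normal 0 (P ** diag_matrix b ** transpose P))"
    unfolding multivariate_normal_diag_conjugate[OF P a] multivariate_normal_diag_conjugate[OF P b]
    by (simp add: couplings_def \<pi>_def distr_distr comp_def X_def[abs_def] Y_def[abs_def])
  then have "W2_sq (multivariate_normal 0 (P ** diag_matrix a ** transpose P))
      (multivariate_normal 0 (P ** diag_matrix b ** transpose P))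
    \<le> (\<integral>\<^sup>+ (x, y). ennreal ((norm (x - y))\<^sup>2) \<partial>\<pi>)"
    unfolding W2_sq_def by (rule INF_lower)
  also have "\<dots> = (\<integral>\<^sup>+ z. ennreal ((norm (X z - Y z))\<^sup>2) \<partial>std_gaussian)"
    unfolding \<pi>_def by (subst nn_integral_distr) (simp_all add: case_prod_beta')
  also have "\<dots> = ennreal (\<Sum>j\<in>UNIV. (vec_sqrt a $ j - vec_sqrt b $ j)\<^sup>2)"
    unfolding X_def Y_def by (rule gaussian_coupling_cost[OF P])
  finally show ?thesis .
qed

lemma vec_sqrt_nonneg:
  assumes "\<And>i. 0 \<le> a $ i"
  shows "0 \<le> vec_sqrt a $ i"
  using assms by (simp add: vec_sqrt_def)

lemma mono_vec_sqrt:
  fixes a :: "real ^ 'n::{finite,linorder}"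
  assumes "\<And>i j. i \<le> j \<Longrightarrow> a $ i \<le> a $ j"
  shows "mono (($) (vec_sqrt a))"
  using assms by (simp add: mono_def vec_sqrt_def)

text \<open>\<open>T\<close> rescales each axis by the ratio of standard deviations and so realizes
  the coupling by a common \<open>z\<close>. The assumption \<open>W2\<close> makes its cost
  minimal; any other optimal map must rescale the axes in the same way almost everywhere.\<close>

lemma aligned_gaussian_optimal_map:
  fixes P :: "real ^ 'n ^ 'n"
  assumes P: "orthogonal_matrix P" and a: "\<And>i. 0 < a $ i" and b: "\<And>i. 0 \<le> b $ i"
  defines "\<mu> \<equiv> multivariate_normal 0 (P ** diag_matrix a ** transpose P)"
    and "\<nu> \<equiv> multivariate_normal 0 (P ** diag_matrix b ** transpose P)"
    and "T x \<equiv> P *v (diag_matrix (\<chi> j. vec_sqrt b $ j / vec_sqrt a $ j) *v (transpose P *v x))"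
  assumes W2: "W2_sq \<mu> \<nu> = ennreal (\<Sum>j\<in>UNIV. (vec_sqrt a $ j - vec_sqrt b $ j)\<^sup>2)"
  shows "W2_optimal_map \<mu> \<nu> T"
    and "W2_optimal_map \<mu> \<nu> U \<Longrightarrow> AE x in \<mu>. U x = T x"
proof -
  have a': "0 \<le> a $ i" for i using a less_imp_le by blast
  have s: "0 < vec_sqrt a $ i" for i using a by (simp add: vec_sqrt_def)
  have \<mu>: "\<mu> = distr std_gaussian borel (\<lambda>z. P *v (diag_matrix (vec_sqrt a) *v z))"
    unfolding \<mu>_def by (rule multivariate_normal_diag_conjugate[OF P a'])
  have \<nu>: "\<nu> = distr std_gaussian borel (\<lambda>z. P *v (diag_matrix (vec_sqrt b) *v z))"
    unfolding \<nu>_def by (rule multivariate_normal_diag_conjugate[OF P b])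
  have [measurable]: "T \<in> borel_measurable borel"
    unfolding T_def[abs_def] by measurable
  have T: "T (P *v (diag_matrix (vec_sqrt a) *v z)) = P *v (diag_matrix (vec_sqrt b) *v z)" for z
  proof -
    have "diag_matrix (\<chi> j. vec_sqrt b $ j / vec_sqrt a $ j) *v (diag_matrix (vec_sqrt a) *v z)
      = diag_matrix (vec_sqrt b) *v z"
      using s by (simp add: vec_eq_iff diag_matrix_mult_vector less_imp_neq[symmetric])
    then show ?thesis
      by (simp add: T_def orthogonal_matrix_cancel[OF P] del: transpose_matrix_vector)
  qed
  show "W2_optimal_map \<mu> \<nu> T"
    unfolding W2_optimal_map_def W2 unfolding \<mu> \<nu>
    by (simp add: distr_distr comp_def T nn_integral_distr gaussian_coupling_cost[OF P])
  assume U: "W2_optimal_map \<mu> \<nu> U"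
  then have [measurable]: "U \<in> borel_measurable borel"
    by (simp add: W2_optimal_map_def)
  have "AE x in \<mu>. \<forall>j. (transpose P *v U x) $ j = vec_sqrt b $ j / vec_sqrt a $ j * (transpose P *v x) $ j"
  proof (rule optimal_transport_map_components)
    show "has_principal_axes \<mu> P (vec_sqrt a)"
      unfolding \<mu>_def by (rule multivariate_normal_principal_axes[OF P a'])
    show "has_principal_axes (distr \<mu> borel U) P (vec_sqrt b)"
      using multivariate_normal_principal_axes[OF P b] U by (simp add: W2_optimal_map_def \<nu>_def)
    show "(\<integral>\<^sup>+ x. ennreal ((norm (x - U x))\<^sup>2) \<partial>\<mu>) \<le> ennreal (\<Sum>j\<in>UNIV. (vec_sqrt a $ j - vec_sqrt b $ j)\<^sup>2)"
      using U W2 by (simp add: W2_optimal_map_def)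
  qed (use s vec_sqrt_nonneg[OF b] in \<open>simp_all add: \<mu>_def multivariate_normal_def\<close>)
  then show "AE x in \<mu>. U x = T x"
  proof eventually_elim
    case (elim x)
    then have "transpose P *v U x
      = diag_matrix (\<chi> j. vec_sqrt b $ j / vec_sqrt a $ j) *v (transpose P *v x)"
      by (simp add: vec_eq_iff diag_matrix_mult_vector del: transpose_matrix_vector)
    then show ?case
      by (metis T_def orthogonal_matrix_cancel(6)[OF P])
  qed
qed

theorem theorem4:
  fixes m0 m1 a0 a1 :: "real ^ 'n::{finite,linorder}"
    and \<Sigma>0 \<Sigma>1 P0 P1 :: "real ^ 'n::{finite,linorder} ^ 'n::{finite,linorder}"
    and \<mu>0 \<mu>1 :: "(real ^ 'n::{finite,linorder}) measure"
  assumes "pos_semidef \<Sigma>0" and "pos_semidef \<Sigma>1"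
    and "\<mu>0 = multivariate_normal m0 \<Sigma>0" and "\<mu>1 = multivariate_normal m1 \<Sigma>1"
    and "orthogonal_matrix P0" and "\<Sigma>0 = P0 ** diag_matrix a0 ** transpose P0"
    and "orthogonal_matrix P1" and "\<Sigma>1 = P1 ** diag_matrix a1 ** transpose P1"
    and "\<And>i j. i \<le> j \<Longrightarrow> a0 $ i \<le> a0 $ j"
    and "\<And>i j. i \<le> j \<Longrightarrow> a1 $ i \<le> a1 $ j"
  shows "PW_sq \<mu>0 \<mu>1 = ennreal ((norm (vec_sqrt a0 - vec_sqrt a1))\<^sup>2)
    \<and> (norm (vec_sqrt a0 - vec_sqrt a1))\<^sup>2 = (\<Sum>j\<in>UNIV. (sqrt (a0 $ j) - sqrt (a1 $ j))\<^sup>2)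
    \<and> PW_optimal_orthogonal \<mu>0 \<mu>1 (P1 ** transpose P0)
    \<and> (pos_def \<Sigma>0 \<longrightarrow>
        (let \<gamma>0 = multivariate_normal 0 (P1 ** transpose P0 ** \<Sigma>0 ** P0 ** transpose P1);
             \<gamma>1 = multivariate_normal 0 \<Sigma>1
         in (\<exists>T. W2_optimal_map \<gamma>0 \<gamma>1 T)
          \<and> (\<forall>T T'. W2_optimal_map \<gamma>0 \<gamma>1 T \<longrightarrow> W2_optimal_map \<gamma>0 \<gamma>1 T' \<longrightarrow> (AE x in \<gamma>0. T x = T' x))
          \<and> (\<forall>T. PW_optimal_monge_map \<mu>0 \<mu>1 (P1 ** transpose P0) T \<longleftrightarrow> W2_optimal_map \<gamma>0 \<gamma>1 T)))"
proof -
  note P0 = assms(5) and P1 = assms(7) and \<Sigma>0 = assms(6) and \<Sigma>1 = assms(8)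
  define r where "r = (\<Sum>j\<in>UNIV. (vec_sqrt a0 $ j - vec_sqrt a1 $ j)\<^sup>2)"
  define \<gamma>0 where "\<gamma>0 = multivariate_normal 0 (P1 ** transpose P0 ** \<Sigma>0 ** P0 ** transpose P1)"
  define \<gamma>1 where "\<gamma>1 = multivariate_normal 0 \<Sigma>1"
  define \<theta> where "\<theta> = P1 ** transpose P0"
  have a0: "0 \<le> a0 $ i" and a1: "0 \<le> a1 $ i" for i
    using assms(1,2) pos_semidef_eigenvalue_nonneg[OF P0] pos_semidef_eigenvalue_nonneg[OF P1]
    unfolding \<Sigma>0 \<Sigma>1 by auto
  have \<theta>: "orthogonal_matrix \<theta>"
    by (simp add: \<theta>_def orthogonal_matrix_mul P0 P1)
  have \<gamma>0: "\<gamma>0 = multivariate_normal 0 (P1 ** diag_matrix a0 ** transpose P1)"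
    by (simp add: \<gamma>0_def \<Sigma>0 matrix_mul_assoc orthogonal_matrix_cancel[OF P0])
  \<comment> \<open>Every admissible source is a Gaussian with the same eigenvalues
    \<open>a0\<close> in the frame \<open>\<eta> ** P0\<close>.\<close>
  have source: "pushforward_matrix \<eta> (centered \<mu>0)
    = multivariate_normal 0 ((\<eta> ** P0) ** diag_matrix a0 ** transpose (\<eta> ** P0))"
    if "orthogonal_matrix \<eta>" for \<eta>
    by (simp add: assms(3) \<Sigma>0 centered_multivariate_normal pushforward_multivariate_normal[OF that P0 a0])
  have target: "centered \<mu>1 = \<gamma>1"
    by (simp add: assms(4) \<gamma>1_def centered_multivariate_normal)
  \<comment> \<open>The choice of \<open>\<theta>\<close> makes \<open>\<theta> ** P0\<close> equal
    to \<open>P1\<close>, the eigenbasis of the target.\<close>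
  have aligned: "pushforward_matrix \<theta> (centered \<mu>0) = \<gamma>0"
    by (simp add: source[OF \<theta>] \<gamma>0) (simp add: \<theta>_def orthogonal_matrix_cancel[OF P0])
  \<comment> \<open>The bound is uniform in \<open>\<eta>\<close>, hence bounds the infimum; the
    order of the eigenvalues enters here.\<close>
  have lower: "ennreal r \<le> W2_sq (pushforward_matrix \<eta> (centered \<mu>0)) (centered \<mu>1)"
    if "orthogonal_matrix \<eta>" for \<eta>
    unfolding source[OF that] target \<gamma>1_def \<Sigma>1 r_def
    by (rule W2_sq_principal_axes_ge[OF multivariate_normal_principal_axes multivariate_normal_principal_axes])
      (simp_all add: orthogonal_matrix_mul mono_vec_sqrt vec_sqrt_nonneg assms(9,10) a0 a1 that P0 P1)
  have "W2_sq \<gamma>0 \<gamma>1 \<le> ennreal r"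
    unfolding \<gamma>0 \<gamma>1_def \<Sigma>1 r_def by (rule W2_sq_multivariate_normal_aligned_le[OF P1 a0 a1])
  then have W2: "W2_sq \<gamma>0 \<gamma>1 = ennreal r"
    using lower[OF \<theta>] by (simp add: aligned target)
  have PW: "PW_sq \<mu>0 \<mu>1 = ennreal r"
    unfolding PW_sq_def
  proof (rule antisym)
    show "(INF \<eta>\<in>{\<eta>. orthogonal_matrix \<eta>}. W2_sq (pushforward_matrix \<eta> (centered \<mu>0)) (centered \<mu>1)) \<le> ennreal r"
      using \<theta> by (intro INF_lower2[of \<theta>]) (simp_all add: aligned target W2)
  qed (auto intro: INF_greatest lower)
  have r: "r = (norm (vec_sqrt a0 - vec_sqrt a1))\<^sup>2"
    unfolding r_def power2_norm_eq_inner by (simp add: inner_vec_def power2_eq_square)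
  have "(\<exists>T. W2_optimal_map \<gamma>0 \<gamma>1 T)
      \<and> (\<forall>T T'. W2_optimal_map \<gamma>0 \<gamma>1 T \<longrightarrow> W2_optimal_map \<gamma>0 \<gamma>1 T' \<longrightarrow> (AE x in \<gamma>0. T x = T' x))"
    if "pos_def \<Sigma>0"
  proof -
    have "0 < a0 $ i" for i
      using that pos_def_eigenvalue_pos[OF P0] unfolding \<Sigma>0 by auto
    note opt = aligned_gaussian_optimal_map[OF P1 this a1, folded \<gamma>0 \<Sigma>1, folded \<gamma>1_def r_def, OF W2]
    show ?thesis
    proof (intro conjI allI impI)
      show "\<exists>T. W2_optimal_map \<gamma>0 \<gamma>1 T"
        using opt(1) by blast
      fix T T' assume T: "W2_optimal_map \<gamma>0 \<gamma>1 T" and T': "W2_optimal_map \<gamma>0 \<gamma>1 T'"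
      from opt(2)[OF T] opt(2)[OF T'] show "AE x in \<gamma>0. T x = T' x"
        by eventually_elim simp
    qed
  qed
  \<comment> \<open>The two notions have the same source and target, and their costs agree because
    \<open>W2_sq \<gamma>0 \<gamma>1\<close> and \<open>PW_sq \<mu>0 \<mu>1\<close> both equal
    \<open>ennreal r\<close>.\<close>
  moreover have "PW_optimal_monge_map \<mu>0 \<mu>1 \<theta> T \<longleftrightarrow> W2_optimal_map \<gamma>0 \<gamma>1 T" for T
    by (simp add: PW_optimal_monge_map_def W2_optimal_map_def aligned target PW W2 \<theta>)
  moreover have "PW_optimal_orthogonal \<mu>0 \<mu>1 \<theta>"
    by (simp add: PW_optimal_orthogonal_def \<theta> aligned target PW W2)
  moreover have "(norm (vec_sqrt a0 - vec_sqrt a1))\<^sup>2 = (\<Sum>j\<in>UNIV. (sqrt (a0 $ j) - sqrt (a1 $ j))\<^sup>2)"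
    unfolding r[symmetric] by (simp add: r_def vec_sqrt_def)
  ultimately show ?thesis
    unfolding Let_def \<gamma>0_def[symmetric] \<gamma>1_def[symmetric] unfolding \<theta>_def[symmetric] using PW r by simp
qed

end
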